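(* Let $n \in \mathbb{N}$ and let $p(x) \in \mathcal{P}_n[x]$. Then: (a) The polynomial $\mathcal{A}^\circ(p(x))$ has only real roots. Moreover, $\mathcal{A}^\circ(p(x)) \preceq xA_n(x)$ and $\mathcal{A}^\circ((1+x)^n) \preceq \mathcal{A}^\circ(p(x))$. (b) The polynomial $\mathcal{A}^\circ(p(x))$ has a real-rooted and interlacing (in particular, unimodal and $\gamma$-positive) symmetric decomposition with respect to $n$.
   Context: For $w$ in the symmetric group $\mathfrak{S}_n$ of permutations of $[n]=\{1,\dots,n\}$, let $\mathrm{des}(w)=\#\{i\in[n-1]: w(i)>w(i+1)\}$. The $n$th Eulerian polynomial is $A_n(x)=\sum_{w\in\mathfrak{S}_n}x^{\mathrm{des}(w)}$, with $A_0(x)=1$. The Eulerian transformation $\mathcal{A}^\circ:\mathbb{R}[x]\to\mathbb{R}[x]$ is the linear map with $\mathcal{A}^\circ(1)=1$ and $\mathcal{A}^\circ(x^m)=xA_m(x)$ for $m\ge 1$. $\mathcal{P}_n[x]$ denotes the set of polynomials of the form $\sum_{k=0}^n c_k x^{n-k}(1+x)^k$ with $c_0,\dots,c_n\ge 0$. A polynomial is real-rooted if all its roots are real or it is identically zero. For real-rooted $p,q$ with roots $\alpha_1\ge\alpha_2\ge\cdots$ and $\beta_1\ge\beta_2\ge\cdots$, write $p\preceq q$ ($p$ interlaces $q$) if $\cdots\le\alpha_2\le\beta_2\le\alpha_1\le\beta_1$; by convention the zero polynomial interlaces and is interlaced by every real-rooted polynomial, and nonzero constants interlace all polynomials of degree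 at most one. A polynomial $a(x)=\sum_{i} a_i x^i\in\mathbb{R}_m[x]$ (degree at most $m$) is symmetric with center $m/2$ if $a_i=a_{m-i}$ for all $i$; unimodal if $0\le a_0\le\cdots\le a_k\ge a_{k+1}\ge\cdots\ge a_m\ge 0$ for some $k$; $\gamma$-positive with center $m/2$ if $a(x)=\sum_{i=0}^{\lfloor m/2\rfloor}\gamma_i x^i(1+x)^{m-2i}$ with all $\gamma_i\ge 0$. Every $p(x)\in\mathbb{R}_n[x]$ can be written uniquely as $p(x)=a(x)+xb(x)$ with $a\in\mathbb{R}_n[x]$ symmetric with center $n/2$ and $b\in\mathbb{R}_{n-1}[x]$ symmetric with center $(n-1)/2$ (the symmetric decomposition with respect to $n$). It is called nonnegative / unimodal / $\gamma$-positive / real-rooted if both $a$ and $b$ have nonnegative coefficients / are unimodal / are $\gamma$-positive (with centers $n/2$ and $(n-1)/2$) / are real-rooted; a nonnegative real-rooted symmetric decomposition is interlacing if moreover $b(x)\preceq a(x)$. *)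

theory Defs
  imports "HOL-Analysis.Analysis" "HOL-Computational_Algebra.Polynomial" "HOL-Combinatorics.Permutations"
begin

definition des :: "nat \<Rightarrow> (nat \<Rightarrow> nat) \<Rightarrow> nat" where
  "des n w = card {i \<in> {1..<n}. w i > w (i + 1)}"

definition eulerian_poly :: "nat \<Rightarrow> real poly" where
  "eulerian_poly n = (\<Sum>w | w permutes {1..n}. monom 1 (des n w))"

lemma eulerian_poly_0: "eulerian_poly 0 = 1"
  by (simp add: eulerian_poly_def des_def)

definition eulerian_transform :: "real poly \<Rightarrow> real poly" where
  "eulerian_transform p =
     (\<Sum>m\<le>degree p. smult (coeff p m) (if m = 0 then 1 else [:0, 1:] * eulerian_poly m))"

text \<open>The explicit formula above is the linear map with the prescribed values on monomials.\<close>

lemma eulerian_transform_ge_degree: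
  assumes "degree p \<le> N"
  shows "eulerian_transform p =
    (\<Sum>m\<le>N. smult (coeff p m) (if m = 0 then 1 else [:0, 1:] * eulerian_poly m))"
  unfolding eulerian_transform_def
  by (rule sum.mono_neutral_left) (use assms in \<open>auto simp: coeff_eq_0\<close>)

lemma eulerian_transform_add:
  "eulerian_transform (p + q) = eulerian_transform p + eulerian_transform q"
proof -
  let ?N = "max (degree p) (degree q)"
  have "degree (p + q) \<le> ?N" "degree p \<le> ?N" "degree q \<le> ?N"
    by (simp_all add: degree_add_le)
  thus ?thesis
    by (simp only: eulerian_transform_ge_degree[where N = ?N] coeff_add smult_add_left sum.distrib)
qed

lemma smult_sum_poly: "smult c (\<Sum>i\<in>A. f i) = (\<Sum>i\<in>A. smult c (f i))"
  by (induction A rule: infinite_finite_induct) (simp_all add: smult_add_right)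

lemma eulerian_transform_smult:
  "eulerian_transform (smult c p) = smult c (eulerian_transform p)"
  using degree_smult_le[of c p]
  by (simp only: eulerian_transform_ge_degree[where N = "degree p"] coeff_smult smult_sum_poly
      smult_smult order_refl)

lemma eulerian_transform_1: "eulerian_transform 1 = 1"
  by (simp add: eulerian_transform_def)

lemma eulerian_transform_monom:
  assumes "m \<ge> 1"
  shows "eulerian_transform (monom 1 m) = [:0, 1:] * eulerian_poly m"
proof -
  have "eulerian_transform (monom 1 m) =
    (\<Sum>i\<le>m. if i = m then [:0, 1:] * eulerian_poly m else 0)"
    unfolding eulerian_transform_def
    by (rule sum.cong) (use assms in \<open>auto simp: degree_monom_eq\<close>)
  thus ?thesis by simp
qed

definition P_class :: "nat \<Rightarrow> real poly set" where
  "P_class n = {p. \<exists>c :: nat \<Rightarrow> real. (\<forall>k\<le>n. c k \<ge> 0) \<and>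
     p = (\<Sum>k\<le>n. smult (c k) ([:0, 1:] ^ (n - k) * [:1, 1:] ^ k))}"

definition real_rooted :: "real poly \<Rightarrow> bool" where
  "real_rooted p \<longleftrightarrow>
     p = 0 \<or> (\<forall>z :: complex. poly (map_poly complex_of_real p) z = 0 \<longrightarrow> z \<in> \<real>)"

definition roots_desc :: "real poly \<Rightarrow> real list" where
  "roots_desc p = rev (sorted_list_of_multiset (proots p))"

text \<open>
  The chain of roots \<open>\<dots> \<le> \<alpha>\<^sub>2 \<le> \<beta>\<^sub>2 \<le> \<alpha>\<^sub>1 \<le> \<beta>\<^sub>1\<close> exhausts both root sequences (with multiplicity) and
  alternates, so \<open>q\<close> has as many roots as \<open>p\<close> or exactly one more. This covers the convention that
  nonzero constants interlace all polynomials of degree at most one. Indices are shifted by one,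
  as lists are indexed from 0.
\<close>

definition interlaces :: "real poly \<Rightarrow> real poly \<Rightarrow> bool" (infix \<open>\<preceq>\<close> 50) where
  "p \<preceq> q \<longleftrightarrow> real_rooted p \<and> real_rooted q \<and>
     (p = 0 \<or> q = 0 \<or>
       (let \<alpha> = roots_desc p; \<beta> = roots_desc q in
          (length \<beta> = length \<alpha> \<or> length \<beta> = length \<alpha> + 1) \<and>
          (\<forall>i < length \<alpha>. \<alpha> ! i \<le> \<beta> ! i) \<and>
          (\<forall>i. i + 1 < length \<beta> \<longrightarrow> \<beta> ! (i + 1) \<le> \<alpha> ! i)))"

definition nonneg_coeffs :: "real poly \<Rightarrow> bool" where
  "nonneg_coeffs p \<longleftrightarrow> (\<forall>i. coeff p i \<ge> 0)"

text \<open>In the next three definitions the parameter \<open>m\<close> is twice the center of symmetry.\<close>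

definition symmetric_poly :: "nat \<Rightarrow> real poly \<Rightarrow> bool" where
  "symmetric_poly m a \<longleftrightarrow> degree a \<le> m \<and> (\<forall>i\<le>m. coeff a i = coeff a (m - i))"

definition unimodal :: "nat \<Rightarrow> real poly \<Rightarrow> bool" where
  "unimodal m a \<longleftrightarrow> degree a \<le> m \<and>
     (\<exists>k\<le>m. 0 \<le> coeff a 0 \<and> (\<forall>i<k. coeff a i \<le> coeff a (i + 1)) \<and>
        (\<forall>i. k \<le> i \<and> i < m \<longrightarrow> coeff a (i + 1) \<le> coeff a i) \<and> 0 \<le> coeff a m)"

definition gamma_positive :: "nat \<Rightarrow> real poly \<Rightarrow> bool" where
  "gamma_positive m a \<longleftrightarrow>
     (\<exists>\<gamma> :: nat \<Rightarrow> real. (\<forall>i\<le>m div 2. \<gamma> i \<ge> 0) \<and>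
        a = (\<Sum>i\<le>m div 2. smult (\<gamma> i) ([:0, 1:] ^ i * [:1, 1:] ^ (m - 2 * i))))"

text \<open>For \<open>n = 0\<close> the polynomial \<open>b\<close> has degree at most \<open>-1\<close>, i.e. it is zero.\<close>

definition symmetric_decomposition ::
    "nat \<Rightarrow> real poly \<Rightarrow> real poly \<Rightarrow> real poly \<Rightarrow> bool" where
  "symmetric_decomposition n p a b \<longleftrightarrow>
     symmetric_poly n a \<and> (if n = 0 then b = 0 else symmetric_poly (n - 1) b) \<and>
     p = a + [:0, 1:] * b"

lemma symmetric_decomposition_unique:
  assumes "symmetric_decomposition n p a b" "symmetric_decomposition n p a' b'"
  shows "a = a' \<and> b = b'"
proof (cases "n = 0")
  case True
  thus ?thesis using assms by (simp add: symmetric_decomposition_def)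
next
  case False
  define d where "d = a - a'"
  define e where "e = b - b'"
  have diff: "symmetric_poly m (f - g)" if "symmetric_poly m f" "symmetric_poly m g" for m f g
    unfolding symmetric_poly_def
  proof (intro conjI allI impI)
    show "degree (f - g) \<le> m"
      using that unfolding symmetric_poly_def by (intro degree_diff_le) blast+
    fix i assume "i \<le> m"
    hence "coeff f i = coeff f (m - i)" "coeff g i = coeff g (m - i)"
      using that unfolding symmetric_poly_def by blast+
    thus "coeff (f - g) i = coeff (f - g) (m - i)"
      by (simp only: coeff_diff)
  qed
  have sd: "symmetric_poly n d" and se: "symmetric_poly (n - 1) e"
    using assms False by (simp_all add: symmetric_decomposition_def d_def e_def diff)
  have eq: "a + pCons 0 b = a' + pCons 0 b'"
    using assms by (simp add: symmetric_decomposition_def)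
  have c: "coeff d i + coeff (pCons 0 e) i = 0" for i
    using arg_cong[OF eq, of "\<lambda>f. coeff f i"] by (cases i) (simp_all add: d_def e_def)
  have step: "coeff d i = 0" if "i \<le> n" for i
    using that
  proof (induction i)
    case 0
    show ?case using c[of 0] by simp
  next
    case (Suc i)
    have "coeff d (n - i) = 0"
      using sd Suc unfolding symmetric_poly_def by (metis Suc_leD)
    moreover have "n - i = Suc (n - 1 - i)" using Suc.prems by simp
    ultimately have "coeff e (n - 1 - i) = 0" using c[of "n - i"] by simp
    moreover have "coeff e i = coeff e (n - 1 - i)"
    proof -
      have "i \<le> n - 1" using Suc.prems by simp
      thus ?thesis using se unfolding symmetric_poly_def by blast
    qed
    ultimately show ?case using c[of "Suc i"] by simp
  qed
  have "coeff d i = 0" for i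
  proof (cases "i \<le> n")
    case False
    moreover have "degree d \<le> n" using sd unfolding symmetric_poly_def by blast
    ultimately show ?thesis by (simp add: coeff_eq_0)
  qed (rule step)
  hence "d = 0" by (simp add: poly_eq_iff)
  moreover have "e = 0"
    using c[of "Suc i" for i] \<open>d = 0\<close> by (simp add: poly_eq_iff)
  ultimately show ?thesis by (simp add: d_def e_def)
qed

end

theory Submission
  imports Defs
begin

text \<open>
  Let \<open>h\<^sub>n\<^sub>,\<^sub>j\<close> be the descent polynomial of the permutations of \<open>[n+1]\<close> starting with \<open>j+1\<close>, so that
  \<open>h\<^sub>n\<^sub>,\<^sub>0 = A\<^sub>n\<close> and \<open>h\<^sub>n\<^sub>,\<^sub>n = x A\<^sub>n\<close>. At every \<open>x < 0\<close> the sequence \<open>h\<^sub>n\<^sub>,\<^sub>0(x), \<dots>, h\<^sub>n\<^sub>,\<^sub>n(x)\<close> changes sign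
  exactly once, and if \<open>A\<^sub>n(x) = 0\<close> its interior terms all have the same sign. Writing
  \<open>(1-x)(1+y) = (y+1-x) - x y\<close>, the transform of \<open>x\<^sup>n\<^sup>-\<^sup>k(1+x)\<^sup>k\<close>, evaluated at \<open>x < 0\<close>, is a nonnegative
  combination of these numbers. Hence every \<open>\<A>\<^sup>\<circ>(p)\<close> alternates in sign along the roots of \<open>A\<^sub>n\<close>. In
  particular so does \<open>\<A>\<^sup>\<circ>((1+x)\<^sup>n)\<close>, and since averaging adjacent terms preserves the single sign change,
  the sign of \<open>\<A>\<^sup>\<circ>(p)\<close> at the roots of \<open>\<A>\<^sup>\<circ>((1+x)\<^sup>n)\<close> is known too; this locates all roots.

  If \<open>\<A>\<^sup>\<circ>(p)\<close> has symmetric decomposition \<open>a + x b\<close>, then \<open>b\<close> alternates along the roots of \<open>\<A>\<^sup>\<circ>((1+x)\<^sup>n)\<close>,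
  and at the roots of \<open>b\<close> the polynomial \<open>a\<close> has the sign of \<open>\<A>\<^sup>\<circ>((1+x)\<^sup>n)\<close>. Gamma-positivity follows from
  subtraction-free recurrences for the decompositions of the basis polynomials.
\<close>

section \<open>Eulerian polynomials refined by the first letter\<close>

text \<open>Recursion on the second letter: delete the first letter \<open>j + 1\<close> and
  standardize. The new first letter \<open>i + 1\<close> was preceded by a larger letter iff
  \<open>i < j\<close>, and this descent costs a factor \<open>x\<close>.\<close>

fun first_letter_eulerian :: "nat \<Rightarrow> nat \<Rightarrow> real poly" where
  "first_letter_eulerian 0 j = 1"
| "first_letter_eulerian (Suc n) j =
     [:0, 1:] * (\<Sum>i<j. first_letter_eulerian n i) + (\<Sum>i=j..n. first_letter_eulerian n i)"

section \<open>Deleting and prepending the first letter of a permutation\<close>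

text \<open>The order-preserving relabelling that frees the value \<open>v\<close> for a new first
  letter.\<close>

definition skip :: "nat \<Rightarrow> nat \<Rightarrow> nat" where
  "skip v y = (if y < v then y else Suc y)"

definition prepend_letter :: "nat \<Rightarrow> nat \<Rightarrow> (nat \<Rightarrow> nat) \<Rightarrow> nat \<Rightarrow> nat" where
  "prepend_letter n v w = (\<lambda>i. if i = 1 then v else if i \<in> {2..Suc n} then skip v (w (i - 1)) else i)"

lemma skip_less_iff: "skip v y < skip v z \<longleftrightarrow> y < z"
  by (auto simp: skip_def)

text \<open>Relabelling is strictly monotone, so the old descents survive one position later; only
  position 1 can add a new one.\<close>

lemma des_prepend_letter:
  assumes "n \<ge> 1" "w permutes {1..n}"
  shows "des (Suc n) (prepend_letter n v w) = (if w 1 < v then 1 else 0) + des n w"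
proof -
  let ?w = "prepend_letter n v w"
  have "{i \<in> {1..<Suc n}. ?w i > ?w (i + 1)} =
      (if w 1 < v then {1} else {}) \<union> Suc ` {i \<in> {1..<n}. w i > w (i + 1)}" (is "?L = ?R")
  proof (rule set_eqI)
    fix i show "i \<in> ?L \<longleftrightarrow> i \<in> ?R"
    proof (cases "i \<le> 1")
      case True
      thus ?thesis using assms(1)
        by (cases i) (auto simp: prepend_letter_def skip_def)
    next
      case False
      then obtain j where j: "i = Suc j" "j \<ge> 1" by (cases i) auto
      have "Suc j \<in> Suc ` A \<longleftrightarrow> j \<in> A" for A by auto
      thus ?thesis using j assms(1)
        by (auto simp: prepend_letter_def skip_less_iff)
    qed
  qed
  moreover have "1 \<notin> Suc ` {i \<in> {1..<n}. w i > w (i + 1)}" by auto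
  ultimately show ?thesis
    unfolding des_def by (simp add: card_image)
qed

text \<open>The inverse deletes the first letter and closes the gap left by its value.\<close>

lemma bij_betw_prepend_letter:
  assumes "v \<in> {1..Suc n}"
  shows "bij_betw (prepend_letter n v) {w. w permutes {1..n}} {w. w permutes {1..Suc n} \<and> w 1 = v}"
proof (rule bij_betwI)
  let ?un = "\<lambda>y. if y < v then y else y - 1"
  let ?inv = "\<lambda>w i. if i \<in> {1..n} then ?un (w (Suc i)) else i"
  show "prepend_letter n v \<in> {w. w permutes {1..n}} \<rightarrow> {w. w permutes {1..Suc n} \<and> w 1 = v}"
  proof (intro funcsetI CollectI conjI)
    fix w assume "w \<in> {w. w permutes {1..n}}"
    hence w: "w permutes {1..n}" by simp
    let ?w = "prepend_letter n v w"
    have rng: "w j \<in> {1..n}" if "j \<in> {1..n}" for j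
      using permutes_in_image[OF w] that by blast
    have "?w ` {1..Suc n} \<subseteq> {1..Suc n}"
    proof (intro image_subsetI)
      fix i assume i: "i \<in> {1..Suc n}"
      show "?w i \<in> {1..Suc n}"
      proof (cases "i = 1")
        case False
        hence "w (i - 1) \<in> {1..n}" using i by (intro rng) auto
        thus ?thesis using assms i by (auto simp: prepend_letter_def skip_def)
      qed (use assms in \<open>simp add: prepend_letter_def\<close>)
    qed
    moreover have "inj_on ?w {1..Suc n}"
    proof (rule inj_onI)
      fix i j assume ij: "i \<in> {1..Suc n}" "j \<in> {1..Suc n}" "?w i = ?w j"
      have ne: "skip v y \<noteq> v" for y by (auto simp: skip_def)
      have inj: "skip v y = skip v z \<longleftrightarrow> y = z" for y z by (auto simp: skip_def)
      have winj: "w y = w z \<longleftrightarrow> y = z" for y z using permutes_inj[OF w] by (auto dest: injD)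
      show "i = j" using ij ne ne[symmetric]
        by (auto simp: prepend_letter_def inj winj split: if_splits)
    qed
    ultimately have "bij_betw ?w {1..Suc n} {1..Suc n}"
      by (simp add: bij_betw_def endo_inj_surj)
    thus "?w permutes {1..Suc n}"
      by (rule bij_imp_permutes) (auto simp: prepend_letter_def)
    show "?w 1 = v" by (simp add: prepend_letter_def)
  qed
  show "?inv \<in> {w. w permutes {1..Suc n} \<and> w 1 = v} \<rightarrow> {w. w permutes {1..n}}"
  proof (intro funcsetI CollectI)
    fix w assume "w \<in> {w. w permutes {1..Suc n} \<and> w 1 = v}"
    hence w: "w permutes {1..Suc n}" and w1: "w 1 = v" by auto
    have winj: "w y = w z \<longleftrightarrow> y = z" for y z using permutes_inj[OF w] by (auto dest: injD)
    have rng: "w j \<in> {1..Suc n}" if "j \<in> {1..Suc n}" for j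
      using permutes_in_image[OF w] that by blast
    have nv: "w (Suc i) \<noteq> v" if "i \<in> {1..n}" for i
      using winj[of "Suc i" 1] w1 that by auto
    have "?inv w ` {1..n} \<subseteq> {1..n}"
    proof (intro image_subsetI)
      fix i assume i: "i \<in> {1..n}"
      thus "?inv w i \<in> {1..n}" using assms rng[of "Suc i"] nv[OF i] by auto
    qed
    moreover have "inj_on (?inv w) {1..n}"
    proof (rule inj_onI)
      fix i j assume ij: "i \<in> {1..n}" "j \<in> {1..n}" "?inv w i = ?inv w j"
      have "w (Suc i) = w (Suc j)" using ij nv[OF ij(1)] nv[OF ij(2)]
        by (auto split: if_splits)
      thus "i = j" by (simp add: winj)
    qed
    ultimately have "bij_betw (?inv w) {1..n} {1..n}"
      by (simp only: bij_betw_def endo_inj_surj finite_atLeastAtMost simp_thms)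
    thus "?inv w permutes {1..n}" by (rule bij_imp_permutes) auto
  qed
  show "?inv (prepend_letter n v w) = w" if "w \<in> {w. w permutes {1..n}}" for w
  proof
    fix i show "?inv (prepend_letter n v w) i = w i"
      using that permutes_not_in[of w "{1..n}" i]
      by (auto simp: prepend_letter_def skip_def)
  qed
  show "prepend_letter n v (?inv w) = w" if "w \<in> {w. w permutes {1..Suc n} \<and> w 1 = v}" for w
  proof
    fix i
    have w: "w permutes {1..Suc n}" and w1: "w 1 = v" using that by auto
    have "w i = v \<longleftrightarrow> i = 1" using permutes_inj[OF w] w1 by (auto dest: injD)
    moreover have "w i = i" if "i \<notin> {1..Suc n}" using permutes_not_in[OF w that] .
    ultimately show "prepend_letter n v (?inv w) i = w i"
      using w1 by (auto simp: prepend_letter_def skip_def)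
  qed
qed

lemma sum_permutes_split_first_letter:
  fixes f :: "(nat \<Rightarrow> nat) \<Rightarrow> real poly"
  assumes "n \<ge> 1"
  shows "(\<Sum>w | w permutes {1..n}. f w) = (\<Sum>i<n. \<Sum>w | w permutes {1..n} \<and> w 1 = Suc i. f w)"
proof -
  have fin: "finite {w. w permutes {1..n}}" by (simp add: finite_permutations)
  have im: "(\<lambda>w. w 1 - 1) ` {w. w permutes {1..n}} \<subseteq> {..<n}"
  proof (intro image_subsetI)
    fix w assume "w \<in> {w. w permutes {1..n}}"
    hence "w 1 \<in> {1..n}" using permutes_in_image[of w "{1..n}" 1] assms by auto
    thus "w 1 - 1 \<in> {..<n}" by auto
  qed
  have "(\<Sum>w | w permutes {1..n}. f w) =
      (\<Sum>i<n. \<Sum>w \<in> {w \<in> {w. w permutes {1..n}}. w 1 - 1 = i}. f w)"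
    using sum.group[OF fin _ im, of f] by simp
  also have "\<dots> = (\<Sum>i<n. \<Sum>w | w permutes {1..n} \<and> w 1 = Suc i. f w)"
  proof (intro sum.cong refl)
    fix i
    show "{w \<in> {w. w permutes {1..n}}. w 1 - 1 = i} = {w. w permutes {1..n} \<and> w 1 = Suc i}"
    proof -
      have "w 1 \<ge> 1" if "w permutes {1..n}" for w
        using permutes_in_image[OF that, of 1] assms by auto
      hence "w 1 - 1 = i \<longleftrightarrow> w 1 = Suc i" if "w permutes {1..n}" for w
        using that by (metis One_nat_def Suc_pred diff_Suc_1 less_eq_Suc_le)
      thus ?thesis by auto
    qed
  qed
  finally show ?thesis .
qed

lemma sum_monom_des_first_letter:
  assumes "j \<le> n"
  shows "(\<Sum>w | w permutes {1..Suc n} \<and> w 1 = Suc j. monom 1 (des (Suc n) w)) =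
    first_letter_eulerian n j"
  using assms
proof (induction n arbitrary: j)
  case 0
  have "{w. w permutes {1..Suc 0} \<and> w 1 = Suc 0} = {id}"
    by (auto simp: permutes_sing)
  thus ?case using 0 by (simp add: des_def)
next
  case (Suc n)
  have "(\<Sum>w | w permutes {1..Suc (Suc n)} \<and> w 1 = Suc j. monom 1 (des (Suc (Suc n)) w)) =
      (\<Sum>w | w permutes {1..Suc n}. monom (1::real) (des (Suc (Suc n)) (prepend_letter (Suc n) (Suc j) w)))"
    by (rule sum.reindex_bij_betw[OF bij_betw_prepend_letter, symmetric]) (use Suc.prems in auto)
  also have "\<dots> = (\<Sum>w | w permutes {1..Suc n}.
      (if w 1 < Suc j then [:0, 1:] else 1) * monom 1 (des (Suc n) w))"
    by (intro sum.cong refl) (auto simp: des_prepend_letter monom_Suc)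
  also have "\<dots> = (\<Sum>i<Suc n. \<Sum>w | w permutes {1..Suc n} \<and> w 1 = Suc i.
      (if w 1 < Suc j then [:0, 1:] else 1) * monom 1 (des (Suc n) w))"
    by (rule sum_permutes_split_first_letter) simp
  also have "\<dots> = (\<Sum>i<Suc n. (if i < j then [:0, 1:] else 1) * first_letter_eulerian n i)"
  proof (rule sum.cong[OF refl])
    fix i assume "i \<in> {..<Suc n}"
    hence "i \<le> n" by auto
    have "(\<Sum>w | w permutes {1..Suc n} \<and> w 1 = Suc i.
        (if w 1 < Suc j then [:0, 1:] else 1) * monom (1::real) (des (Suc n) w)) =
      (\<Sum>w | w permutes {1..Suc n} \<and> w 1 = Suc i.
        (if i < j then [:0, 1:] else 1) * monom 1 (des (Suc n) w))"
      by (rule sum.cong) auto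
    thus "(\<Sum>w | w permutes {1..Suc n} \<and> w 1 = Suc i.
        (if w 1 < Suc j then [:0, 1:] else 1) * monom (1::real) (des (Suc n) w)) =
        (if i < j then [:0, 1:] else 1) * first_letter_eulerian n i"
      using Suc.IH[OF \<open>i \<le> n\<close>] by (simp only: sum_distrib_left[symmetric])
  qed
  also have "{..<Suc n} = {..<j} \<union> {j..n}" using Suc.prems by auto
  also have "(\<Sum>i\<in>{..<j} \<union> {j..n}. (if i < j then [:0, 1:] else 1) * first_letter_eulerian n i) =
      (\<Sum>i<j. (if i < j then [:0, 1:] else 1) * first_letter_eulerian n i) +
      (\<Sum>i=j..n. (if i < j then [:0, 1:] else 1) * first_letter_eulerian n i)"
    by (rule sum.union_disjoint) auto
  also have "\<dots> = first_letter_eulerian (Suc n) j"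
    by (simp add: sum_distrib_left)
  finally show ?case .
qed

text \<open>A leading letter 1 never creates a descent, so prepending it preserves the descent
  polynomial.\<close>

lemma eulerian_poly_eq: "eulerian_poly n = first_letter_eulerian n 0"
proof (cases n)
  case 0
  thus ?thesis by (simp add: eulerian_poly_0)
next
  case (Suc m)
  have "eulerian_poly n = (\<Sum>i<Suc m. first_letter_eulerian m i)"
    unfolding eulerian_poly_def Suc
    by (subst sum_permutes_split_first_letter) (simp, intro sum.cong refl sum_monom_des_first_letter, simp)
  also have "\<dots> = first_letter_eulerian n 0"
    by (simp add: Suc atLeast0AtMost lessThan_Suc_atMost)
  finally show ?thesis .
qed

section \<open>Polynomials with simple real roots\<close>

text \<open>Reflect \<open>x\<close> to \<open>-x\<close> and use the behaviour at plus
  infinity.\<close>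

lemma poly_alternating_infinity:
  fixes f :: "real poly"
  assumes "lead_coeff f > 0"
  shows "\<exists>y<M. (-1) ^ degree f * poly f y > 0"
proof -
  define g where "g = smult ((-1) ^ degree f) (f \<circ>\<^sub>p [:0, -1:])"
  have "lead_coeff g = lead_coeff f"
    by (simp add: g_def lead_coeff_comp power_mult_distrib[symmetric])
  then obtain K where K: "\<And>x. x \<ge> K \<Longrightarrow> poly g x \<ge> lead_coeff g"
    using poly_pinfty_gt_lc[of g] assms by auto
  define x where "x = max K (1 - M)"
  have "poly g x > 0" using K[of x] \<open>lead_coeff g = lead_coeff f\<close> assms by (auto simp: x_def)
  hence "(-1) ^ degree f * poly f (-x) > 0" by (simp add: g_def poly_pcompose)
  moreover have "-x < M" by (simp add: x_def max_def)
  ultimately show ?thesis by blast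
qed

lemma poly_root_between:
  fixes f :: "real poly"
  assumes "u \<le> v" "s * poly f v \<ge> 0" "s * poly f u \<le> 0" "s \<noteq> 0"
  shows "\<exists>z. u \<le> z \<and> z \<le> v \<and> poly f z = 0"
proof -
  have "\<exists>z. u \<le> z \<and> z \<le> v \<and> poly (smult s f) z = 0"
    using assms by (intro IVT') (auto intro!: continuous_intros)
  thus ?thesis using assms by simp
qed

text \<open>The leading terms cancel in the difference of both sides, which still vanishes at
  \<open>n\<close> distinct points.\<close>

lemma poly_eq_prod_roots:
  fixes f :: "real poly"
  assumes "degree f = n" "inj_on z {..<n}" "\<And>i. i < n \<Longrightarrow> poly f (z i) = 0" "f \<noteq> 0"
  shows "f = smult (lead_coeff f) (\<Prod>i<n. [:- z i, 1:])"
proof -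
  define g where "g = smult (lead_coeff f) (\<Prod>i<n. [:- z i, 1:])"
  have dg: "degree g = n" using assms(4) by (simp add: g_def degree_prod_eq_sum_degree)
  have lg: "lead_coeff g = lead_coeff f" by (simp add: g_def lead_coeff_prod)
  have "f - g = 0"
  proof (rule ccontr)
    assume ne: "f - g \<noteq> 0"
    have "coeff (f - g) n = 0" using dg lg assms(1) by simp
    moreover have "degree (f - g) \<le> n" using dg assms(1) by (simp add: degree_diff_le)
    ultimately have lt: "degree (f - g) < n"
      using ne by (metis le_neq_implies_less leading_coeff_0_iff)
    have "z ` {..<n} \<subseteq> {x. poly (f - g) x = 0}"
      using assms(3) by (auto simp: g_def poly_prod)
    hence "card (z ` {..<n}) \<le> card {x. poly (f - g) x = 0}"
      by (rule card_mono[OF poly_roots_finite[OF ne]])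
    also have "\<dots> \<le> degree (f - g)" by (rule card_poly_roots_bound[OF ne])
    finally show False using lt assms(2) by (simp add: card_image)
  qed
  thus ?thesis by (simp add: g_def)
qed

definition strict_desc_roots :: "real poly \<Rightarrow> nat \<Rightarrow> (nat \<Rightarrow> real) \<Rightarrow> bool" where
  "strict_desc_roots f n z \<longleftrightarrow> f \<noteq> 0 \<and> degree f = n \<and>
     (\<forall>i j. i < j \<longrightarrow> j < n \<longrightarrow> z j < z i) \<and> (\<forall>i<n. poly f (z i) = 0)"

text \<open>An upper bound on the degree suffices, since \<open>n\<close> distinct roots force
  degree at least \<open>n\<close>.\<close>

lemma strict_desc_rootsI:
  assumes "f \<noteq> 0" "degree f \<le> n" "\<And>i. Suc i < n \<Longrightarrow> z (Suc i) < z i" "\<And>i. i < n \<Longrightarrow> poly f (z i) = 0"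
  shows "strict_desc_roots f n z"
proof -
  have desc: "z j < z i" if "i < j" "j < n" for i j
    using that
  proof (induction j)
    case (Suc j)
    thus ?case using assms(3)[of j] by (cases "i = j") force+
  qed simp
  hence "inj_on z {..<n}" by (intro linorder_inj_onI) force+
  hence "n = card (z ` {..<n})" by (simp add: card_image)
  also have "\<dots> \<le> card {x. poly f x = 0}"
    by (rule card_mono) (use assms poly_roots_finite in auto)
  also have "\<dots> \<le> degree f" by (rule card_poly_roots_bound[OF assms(1)])
  finally show ?thesis using desc assms by (auto simp: strict_desc_roots_def)
qed

lemma strict_desc_roots_prod:
  assumes "strict_desc_roots f n z"
  shows "f = smult (lead_coeff f) (\<Prod>i<n. [:- z i, 1:])"
proof (rule poly_eq_prod_roots)
  show "inj_on z {..<n}"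
    by (rule linorder_inj_onI) (use assms in \<open>force simp: strict_desc_roots_def\<close>)+
qed (use assms in \<open>auto simp: strict_desc_roots_def\<close>)

lemma strict_desc_roots_desc:
  assumes "strict_desc_roots f n z"
  shows "roots_desc f = map z [0..<n]"
proof -
  have "lead_coeff f \<noteq> 0" using assms unfolding strict_desc_roots_def leading_coeff_0_iff by blast
  hence "proots f = proots (\<Prod>i<n. [:- z i, 1:])"
    by (subst strict_desc_roots_prod[OF assms]) (rule proots_smult)
  also have "\<dots> = (\<Sum>i<n. {#z i#})"
    by (subst proots_prod) simp_all
  also have "\<dots> = mset (map z [0..<n])"
    by (induction n) auto
  finally have 1: "proots f = mset (rev (map z [0..<n]))" by simp
  have "sorted_wrt (\<lambda>x y. y \<le> x) (map z [0..<n])"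
    using assms unfolding sorted_wrt_iff_nth_less strict_desc_roots_def by (auto intro: less_imp_le)
  hence "sorted (rev (map z [0..<n]))" by (simp only: sorted_wrt_rev)
  thus ?thesis unfolding roots_desc_def 1 by (simp only: sorted_list_of_multiset_mset sorted_sort_id rev_rev_ident)
qed

text \<open>The \<open>n\<close> real roots already exhaust the at most \<open>n\<close> complex
  ones.\<close>

lemma strict_desc_roots_real_rooted:
  assumes "strict_desc_roots f n z"
  shows "real_rooted f"
proof -
  let ?g = "map_poly complex_of_real f"
  let ?Z = "{w. poly ?g w = 0}"
  have f: "f \<noteq> 0" "degree f = n" and desc: "\<And>i j. i < j \<Longrightarrow> j < n \<Longrightarrow> z j < z i"
    and root: "\<And>i. i < n \<Longrightarrow> poly f (z i) = 0"
    using assms by (auto simp: strict_desc_roots_def)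
  have g: "?g \<noteq> 0" using f by (simp add: map_poly_eq_0_iff)
  have "inj_on (\<lambda>i. complex_of_real (z i)) {..<n}"
    by (rule linorder_inj_onI) (use desc in force)+
  hence "card ((\<lambda>i. complex_of_real (z i)) ` {..<n}) = n" by (simp add: card_image)
  moreover have "card ?Z \<le> n"
    using card_poly_roots_bound[OF g] f by (simp add: degree_map_poly)
  moreover have "(\<lambda>i. complex_of_real (z i)) ` {..<n} \<subseteq> ?Z"
  proof (intro image_subsetI CollectI)
    fix i assume "i \<in> {..<n}"
    hence "complex_of_real (poly f (z i)) = 0" using root by simp
    thus "poly ?g (complex_of_real (z i)) = 0"
      by (simp add: poly_altdef degree_map_poly coeff_map_poly)
  qed
  ultimately have "(\<lambda>i. complex_of_real (z i)) ` {..<n} = ?Z"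
    by (intro card_seteq poly_roots_finite[OF g]) auto
  hence "?Z \<subseteq> \<real>" by (metis Reals_of_real image_subsetI)
  thus ?thesis unfolding real_rooted_def by blast
qed

text \<open>Here \<open>k\<close> counts the roots to the right of \<open>y\<close>; each
  contributes one negative factor \<open>y - z i\<close>.\<close>

lemma strict_desc_roots_sign:
  assumes "strict_desc_roots f n z" "lead_coeff f > 0" "k \<le> n"
    "\<And>i. i < k \<Longrightarrow> y < z i" "\<And>i. k \<le> i \<Longrightarrow> i < n \<Longrightarrow> z i < y"
  shows "(-1) ^ k * poly f y > 0"
proof -
  have "poly f y = lead_coeff f * (\<Prod>i<n. y - z i)"
    by (subst strict_desc_roots_prod[OF assms(1)]) (simp add: poly_prod)
  also have "{..<n} = {..<k} \<union> {k..<n}" using assms(3) by auto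
  also have "(\<Prod>i\<in>{..<k} \<union> {k..<n}. y - z i) = (\<Prod>i<k. y - z i) * (\<Prod>i=k..<n. y - z i)"
    by (rule prod.union_disjoint) auto
  also have "(\<Prod>i<k. y - z i) = (-1) ^ k * (\<Prod>i<k. z i - y)"
    using prod.distrib[of "\<lambda>_. -1" "\<lambda>i. z i - y" "{..<k}"] by simp
  finally have "(-1) ^ k * poly f y =
      lead_coeff f * (\<Prod>i<k. z i - y) * (\<Prod>i=k..<n. y - z i)"
    by (simp add: power_mult_distrib[symmetric])
  also have "\<dots> > 0"
    using assms by (intro mult_pos_pos prod_pos) auto
  finally show ?thesis .
qed

lemma strict_desc_roots_interlaces:
  assumes "strict_desc_roots f m y" "strict_desc_roots g n z" "n = m \<or> n = Suc m"
    "\<And>i. i < m \<Longrightarrow> y i \<le> z i" "\<And>i. Suc i < n \<Longrightarrow> z (Suc i) \<le> y i"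
  shows "f \<preceq> g"
  using assms strict_desc_roots_real_rooted[OF assms(1)] strict_desc_roots_real_rooted[OF assms(2)]
  by (auto simp: interlaces_def strict_desc_roots_desc[OF assms(1)] strict_desc_roots_desc[OF assms(2)]
      simp del: upt_Suc)

section \<open>Sign patterns at a negative point\<close>

text \<open>Raising \<open>j\<close> by one moves the summand
  \<open>first_letter_eulerian n j\<close> from the plain sum to the one weighted by
  \<open>x\<close>.\<close>

lemma first_letter_eulerian_diff:
  assumes "j \<le> n"
  shows "first_letter_eulerian (Suc n) j - first_letter_eulerian (Suc n) (Suc j) =
    [:1, -1:] * first_letter_eulerian n j"
proof -
  have "{j..n} = insert j {Suc j..n}" using assms by auto
  hence "(\<Sum>i=j..n. first_letter_eulerian n i) =
      first_letter_eulerian n j + (\<Sum>i=Suc j..n. first_letter_eulerian n i)" by simp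
  thus ?thesis by (simp add: algebra_simps)
qed

text \<open>Starting with the largest letter forces a descent, starting with the smallest forbids
  one.\<close>

lemma first_letter_eulerian_last:
  "first_letter_eulerian (Suc n) (Suc n) = [:0, 1:] * first_letter_eulerian (Suc n) 0"
  by (simp add: atLeast0AtMost lessThan_Suc_atMost)

lemma degree_first_letter_eulerian: "degree (first_letter_eulerian n j) \<le> n"
proof (induction n arbitrary: j)
  case (Suc n)
  have "degree (\<Sum>i\<in>A. first_letter_eulerian n i) \<le> n" if "finite A" for A
    using Suc that by (intro degree_sum_le) auto
  from this[of "{..<j}"] this[of "{j..n}"] show ?case
    by (auto intro!: degree_add_le order.trans[OF degree_pCons_le])
qed simp

lemma coeff_first_letter_eulerian_top:
  assumes "j \<le> n"
  shows "coeff (first_letter_eulerian n j) n = (if j = n then 1 else 0)"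
  using assms
proof (induction n arbitrary: j)
  case (Suc n)
  have "coeff (first_letter_eulerian n i) (Suc n) = 0" for i
    using degree_first_letter_eulerian[of n i] by (intro coeff_eq_0) simp
  hence "coeff (first_letter_eulerian (Suc n) j) (Suc n) = (\<Sum>i<j. coeff (first_letter_eulerian n i) n)"
    by (simp add: coeff_sum)
  also have "\<dots> = (\<Sum>i<j. if i = n then 1 else 0)"
    using Suc by (intro sum.cong) auto
  also have "\<dots> = (if j = Suc n then 1 else 0)" using Suc.prems by auto
  finally show ?case .
qed simp

lemma poly_first_letter_eulerian_0:
  assumes "j \<le> n"
  shows "poly (first_letter_eulerian n j) 0 = (if j = 0 then 1 else 0)"
  using assms
proof (induction n arbitrary: j)
  case (Suc n)
  have "poly (first_letter_eulerian (Suc n) j) 0 = (\<Sum>i=j..n. if i = 0 then 1 else 0)"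
    using Suc by (simp add: poly_sum)
  thus ?case by (cases "j = 0") auto
qed simp

section \<open>Propagation of a single sign change through the recursion\<close>

text \<open>Positive terms, then at most one zero, then negative terms, each block possibly empty;
  stated locally so that it can be checked term by term.\<close>

definition down_crossing :: "nat \<Rightarrow> (nat \<Rightarrow> real) \<Rightarrow> bool" where
  "down_crossing n s \<longleftrightarrow> (\<forall>j<n. s j \<le> 0 \<longrightarrow> s (Suc j) < 0)"

lemma down_crossing_mono:
  assumes "down_crossing n s" "s i \<le> 0" "i < j" "j \<le> n"
  shows "s j < 0"
  using assms(3,4)
proof (induction j)
  case (Suc j)
  show ?case
  proof (cases "i = j")
    case False
    hence "s j < 0" using Suc by auto
    thus ?thesis using assms(1) Suc.prems by (auto simp: down_crossing_def)
  qed (use assms Suc.prems in \<open>auto simp: down_crossing_def\<close>)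
qed simp

text \<open>The successive differences of the new sequence are negative multiples of the old one, so
  it first decreases and then increases, ending in \<open>x\<close> times its first term.\<close>

context
  fixes n :: nat and x :: real and s S :: "nat \<Rightarrow> real"
  assumes x: "x < 0"
    and diff_eq: "\<And>j. j \<le> n \<Longrightarrow> S (Suc j) = S j - (1 - x) * s j"
    and final: "S (Suc n) = x * S 0"
begin

lemma prefix_nonneg_decreases:
  assumes "\<And>i. i < j \<Longrightarrow> s i \<ge> 0" "j \<le> Suc n"
  shows "S j \<le> S 0"
  using assms
proof (induction j)
  case (Suc j)
  have "(1 - x) * s j \<ge> 0" using Suc.prems x by simp
  thus ?case using Suc.IH Suc.prems diff_eq[of j] by force
qed simp

lemma suffix_nonpos_increases:
  assumes "\<And>i. j \<le> i \<Longrightarrow> i \<le> n \<Longrightarrow> s i \<le> 0" "j \<le> k" "k \<le> Suc n"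
  shows "S j \<le> S k"
  using assms(2,3)
proof (induction k)
  case (Suc k)
  show ?case
  proof (cases "j = Suc k")
    case False
    hence jk: "j \<le> k" "k \<le> n" using Suc.prems by auto
    hence "(1 - x) * s k \<le> 0" using assms(1)[of k] x by (simp add: mult_nonneg_nonpos)
    thus ?thesis using Suc.IH jk diff_eq[of k] by simp
  qed simp
qed simp

text \<open>If \<open>s j > 0\<close>, then \<open>S\<close> falls strictly at \<open>j\<close>.
  Otherwise \<open>s\<close> is negative after \<open>j\<close>, so \<open>S\<close> climbs from
  \<open>Suc j\<close> to its final value \<open>x * S 0\<close>, which is negative.\<close>

lemma down_crossing_step_pos:
  assumes "down_crossing n s" "S 0 > 0"
  shows "down_crossing (Suc n) S"
  unfolding down_crossing_def
proof (intro allI impI)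
  fix j assume j: "j < Suc n" "S j \<le> 0"
  show "S (Suc j) < 0"
  proof (cases "s j > 0")
    case True
    hence "(1 - x) * s j > 0" using x by simp
    thus ?thesis using diff_eq[of j] j by simp
  next
    case False
    hence "S (Suc j) \<le> S (Suc n)"
      using down_crossing_mono[OF assms(1), of j] j
      by (intro suffix_nonpos_increases) (auto intro: less_imp_le)
    also have "\<dots> < 0" using final assms x by (simp add: mult_neg_pos)
    finally show ?thesis .
  qed
qed

text \<open>To exceed its initial value \<open>S\<close> must have risen before \<open>j\<close>,
  which needs a negative \<open>s i\<close>; from there on \<open>s\<close> stays negative.\<close>

lemma down_crossing_negative_prefix:
  assumes "down_crossing n s" "S 0 < S j" "j \<le> n"
  shows "s j < 0"
proof -
  obtain i where "i < j" "s i < 0"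
    using prefix_nonneg_decreases[of j] assms by force
  thus ?thesis using down_crossing_mono[OF assms(1), of i j] assms by simp
qed

text \<open>Once \<open>S\<close> reaches a nonnegative value it exceeds \<open>S 0\<close>, hence
  is in its rising phase.\<close>

lemma down_crossing_step_neg:
  assumes "down_crossing n s" "S 0 < 0"
  shows "down_crossing (Suc n) (\<lambda>j. - S j)"
  unfolding down_crossing_def
proof (intro allI impI)
  fix j assume j: "j < Suc n" "- S j \<le> 0"
  hence "s j < 0" using down_crossing_negative_prefix[OF assms(1), of j] assms by simp
  hence "(1 - x) * s j < 0" using x by (simp add: mult_pos_neg)
  thus "- S (Suc j) < 0" using diff_eq[of j] j by simp
qed

text \<open>Both ends of \<open>S\<close> vanish and \<open>S\<close> falls at first. If it were
  nonnegative again before the end, it would be rising strictly and could not finish at 0.\<close>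

lemma down_crossing_step_zero:
  assumes "down_crossing n s" "s 0 > 0" "S 0 = 0" "0 < j" "j \<le> n"
  shows "S j < 0"
proof (rule ccontr)
  assume "\<not> S j < 0"
  have s: "s i < 0" if "j \<le> i" "i \<le> n" for i
  proof -
    have "(1 - x) * s 0 > 0" using assms x by simp
    hence "S 1 < 0" using diff_eq[of 0] assms by simp
    \<comment> \<open>Without a negative term before \<open>j\<close>, \<open>S\<close> would not
      have risen since \<open>S 1 < 0\<close>.\<close>
    obtain i' where i': "i' < j" "s i' < 0"
    proof (cases "\<forall>i<j. s i \<ge> 0")
      case True
      have "S j \<le> S 1"
        using True \<open>0 < j\<close> \<open>j \<le> n\<close>
      proof (induction j)
        case (Suc k)
        have "(1 - x) * s k \<ge> 0" using Suc.prems x by simp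
        thus ?case using Suc diff_eq[of k] by (cases "k = 0") force+
      qed simp
      thus ?thesis using \<open>S 1 < 0\<close> \<open>\<not> S j < 0\<close> by simp
    qed (use that in force)
    thus ?thesis using down_crossing_mono[OF assms(1), of i' i] that by simp
  qed
  have "S (Suc j) \<le> S (Suc n)"
    using s assms by (intro suffix_nonpos_increases) (auto intro: less_imp_le)
  moreover have "(1 - x) * s j < 0" using x s[of j] assms by (simp add: mult_pos_neg)
  ultimately show False using diff_eq[of j] assms final \<open>\<not> S j < 0\<close> by simp
qed

text \<open>The step following a zero of the Eulerian polynomial. \<open>S\<close> never rises and
  falls strictly in the interior, so \<open>x * S 0 < S 0\<close>, which forces
  \<open>S 0 > 0\<close>.\<close>

lemma down_crossing_step_degenerate:
  assumes "n \<ge> 2" "\<And>j. 0 < j \<Longrightarrow> j < n \<Longrightarrow> s j > 0" "s 0 = 0" "s n = 0"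
  shows "S 0 > 0" "down_crossing (Suc n) S"
proof -
  have nonneg: "s j \<ge> 0" if "j \<le> n" for j
    using assms that by (cases "j = 0"; cases "j = n") (auto intro: less_imp_le)
  have mono: "S (Suc n) \<le> S j" if "j \<le> Suc n" for j
    using that
  proof (induction rule: inc_induct)
    case (step k)
    have "(1 - x) * s k \<ge> 0" using step nonneg x by simp
    thus ?case using step diff_eq[of k] by simp
  qed simp
  show S0: "S 0 > 0"
  proof (rule ccontr)
    assume "\<not> S 0 > 0"
    hence "S (Suc n) \<ge> 0" using final x by (simp add: mult_nonpos_nonpos)
    moreover have "S 1 = S 0" using diff_eq[of 0] assms by simp
    moreover have "(1 - x) * s 1 > 0" using assms x by simp
    hence "S 2 < S 1" using diff_eq[of 1] assms by (simp add: numeral_2_eq_2)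
    ultimately show False using \<open>\<not> S 0 > 0\<close> mono[of 2] assms by simp
  qed
  show "down_crossing (Suc n) S"
    unfolding down_crossing_def
  proof (intro allI impI)
    fix j assume j: "j < Suc n" "S j \<le> 0"
    show "S (Suc j) < 0"
    proof (cases "j = 0 \<or> j = n")
      case True
      thus ?thesis using j S0 final x by (auto simp: mult_neg_pos)
    next
      case False
      hence "(1 - x) * s j > 0" using assms(2)[of j] j x by simp
      thus ?thesis using diff_eq[of j] j by simp
    qed
  qed
qed

end

lemma poly_first_letter_eulerian_step:
  assumes "j \<le> n"
  shows "poly (first_letter_eulerian (Suc n) (Suc j)) x =
    poly (first_letter_eulerian (Suc n) j) x - (1 - x) * poly (first_letter_eulerian n j) x"
  using arg_cong[OF first_letter_eulerian_diff[OF assms], of "\<lambda>f. poly f x"]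
  by (simp add: algebra_simps del: first_letter_eulerian.simps)

lemma poly_first_letter_eulerian_final:
  "poly (first_letter_eulerian (Suc n) (Suc n)) x = x * poly (first_letter_eulerian (Suc n) 0) x"
  by (subst first_letter_eulerian_last) simp

text \<open>Both cases go through one induction: a zero of \<open>h n 0\<close> destroys the
  crossing, and the common interior sign restores it one step later. The last inequality is the
  Sturm property that later locates the roots.\<close>

lemma sign_pattern_first_letter_eulerian:
  assumes x: "x < 0"
  defines "h \<equiv> \<lambda>n j. poly (first_letter_eulerian n j) x"
  shows "(h n 0 \<noteq> 0 \<longrightarrow> down_crossing n (\<lambda>j. sgn (h n 0) * h n j)) \<and>
    (h n 0 = 0 \<longrightarrow> n \<ge> 2 \<and> (\<forall>j. 0 < j \<longrightarrow> j < n \<longrightarrow> sgn (h (n - 1) 0) * h n j < 0) \<and>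
       h (n - 1) 0 \<noteq> 0 \<and> h (Suc n) 0 * h (n - 1) 0 < 0)"
proof (induction n)
  case 0
  show ?case by (simp add: h_def down_crossing_def)
next
  case (Suc n)
  have step: "c * h (Suc n) (Suc j) = c * h (Suc n) j - (1 - x) * (c * h n j)" if "j \<le> n" for j c
  proof -
    have "h (Suc n) (Suc j) = h (Suc n) j - (1 - x) * h n j"
      using poly_first_letter_eulerian_step[OF that, of x] unfolding h_def .
    thus ?thesis by (simp only: right_diff_distrib mult.left_commute)
  qed
  have final: "c * h (Suc n) (Suc n) = x * (c * h (Suc n) 0)" for c
    using poly_first_letter_eulerian_final[of n x] unfolding h_def by simp
  note facts = x step final
  show ?case
  proof (cases "h n 0 = 0")
    case False
    define c where "c = sgn (h n 0)"
    have c: "c = 1 \<or> c = -1" "c * h n 0 > 0" using False by (auto simp: c_def sgn_if)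
    have dc: "down_crossing n (\<lambda>j. c * h n j)" using Suc False by (simp add: c_def)
    show ?thesis
    proof (cases "h (Suc n) 0 = 0")
      case ne: False
      have "down_crossing (Suc n) (\<lambda>j. sgn (h (Suc n) 0) * h (Suc n) j)"
      proof (cases "c * h (Suc n) 0 > 0")
        case True
        hence "sgn (h (Suc n) 0) = c" using c by (auto simp: sgn_if)
        thus ?thesis
          using down_crossing_step_pos[of x n "\<lambda>j. c * h (Suc n) j", OF facts dc True] by simp
      next
        case False
        hence lt: "c * h (Suc n) 0 < 0" using ne c by (auto simp: not_less)
        hence "sgn (h (Suc n) 0) = - c" using c by (auto simp: sgn_if)
        thus ?thesis
          using down_crossing_step_neg[of x n "\<lambda>j. c * h (Suc n) j", OF facts dc lt] by simp
      qed
      thus ?thesis using ne by simp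
    next
      case z: True
      have neg: "c * h (Suc n) j < 0" if "0 < j" "j \<le> n" for j
        using down_crossing_step_zero[of x n "\<lambda>j. c * h (Suc n) j", OF facts dc c(2) _ that] z by simp
      have "n \<ge> 1"
      proof (rule ccontr)
        assume "\<not> n \<ge> 1"
        hence "n = 0" by simp
        thus False using z by (simp add: h_def)
      qed
      have last: "h (Suc n) (Suc n) = 0" using final[of 1] z by simp
      have "h (Suc (Suc n)) 0 = (\<Sum>j\<in>{0..Suc n}. h (Suc n) j)"
        unfolding h_def
        by (subst first_letter_eulerian.simps(2))
           (simp only: poly_add poly_sum poly_mult lessThan_0 sum.empty poly_0 mult_zero_right add_0)
      hence "c * h (Suc (Suc n)) 0 = (\<Sum>j\<in>{0..Suc n}. c * h (Suc n) j)"
        by (simp only: sum_distrib_left)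
      \<comment> \<open>Both end terms vanish; the interior terms are all negative.\<close>
      also have "\<dots> = (\<Sum>j\<in>{1..n}. c * h (Suc n) j)"
        by (rule sum.mono_neutral_right) (use z last in \<open>auto simp: le_Suc_eq not_less_eq_eq\<close>)
      also have "\<dots> < (\<Sum>j\<in>{1..n}. 0)"
        by (rule sum_strict_mono) (use neg \<open>n \<ge> 1\<close> in auto)
      finally have "c * h (Suc (Suc n)) 0 < 0" by simp
      hence "h (Suc (Suc n)) 0 * h n 0 < 0"
        using c by (auto simp: mult_less_0_iff zero_less_mult_iff)
      thus ?thesis using z \<open>n \<ge> 1\<close> neg False by (simp add: c_def)
    qed
  next
    case True
    \<comment> \<open>Interior terms at level \<open>n\<close> have the sign opposite to
      \<open>h (n - 1) 0\<close>, so this factor makes them positive.\<close>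
    define c where "c = - sgn (h (n - 1) 0)"
    have n: "n \<ge> 2" and ne: "h (n - 1) 0 \<noteq> 0" and pos: "\<And>j. 0 < j \<Longrightarrow> j < n \<Longrightarrow> c * h n j > 0"
      using Suc True by (auto simp: c_def)
    have c: "c = 1 \<or> c = -1" using ne by (auto simp: c_def sgn_if)
    have "h n n = x * h n 0"
      using poly_first_letter_eulerian_final[of "n - 1" x] n unfolding h_def by (simp del: first_letter_eulerian.simps)
    hence "c * h n n = 0" "c * h n 0 = 0" using True by auto
    note deg = down_crossing_step_degenerate[of x n "\<lambda>j. c * h (Suc n) j" "\<lambda>j. c * h n j",
        OF facts n pos this(2,1)]
    have "sgn (h (Suc n) 0) = c" using deg(1) c by (auto simp: sgn_if)
    thus ?thesis using deg by auto
  qed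
qed

section \<open>Eulerian transforms of the basis of the cone\<close>

text \<open>Let \<open>L\<close> be the \<open>\<real>[x]\<close>-linear map with \<open>L(y\<^sup>m) = \<A>\<^sup>\<circ>(x\<^sup>m)\<close>. Then \<open>tri_eulerian a b c\<close> is the image of
  \<open>y\<^sup>a(1+y)\<^sup>b(y+1-x)\<^sup>c\<close>; replacing \<open>x\<close> by \<open>1/x\<close> and clearing denominators exchanges \<open>a\<close> and \<open>c\<close>.\<close>

fun tri_eulerian :: "nat \<Rightarrow> nat \<Rightarrow> nat \<Rightarrow> real poly" where
  "tri_eulerian a 0 c = first_letter_eulerian (a + c) a"
| "tri_eulerian a (Suc b) c = tri_eulerian (Suc a) b c + tri_eulerian a b c"

text \<open>The identity \<open>1 - x = (y + 1 - x) - y\<close> seen through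
  \<open>L\<close>.\<close>

lemma tri_eulerian_diff:
  "[:1, -1:] * tri_eulerian a b c = tri_eulerian a b (Suc c) - tri_eulerian (Suc a) b c"
proof (induction b arbitrary: a c)
  case 0
  show ?case using first_letter_eulerian_diff[of a "a + c"] by (simp del: first_letter_eulerian.simps)
next
  case (Suc b)
  show ?case by (simp only: tri_eulerian.simps distrib_left Suc)
qed

lemma poly_tri_eulerian_diff:
  "(1 - x) * poly (tri_eulerian a b c) x =
     poly (tri_eulerian a b (Suc c)) x - poly (tri_eulerian (Suc a) b c) x"
  using arg_cong[OF tri_eulerian_diff[of a b c], of "\<lambda>f. poly f x"] by (simp add: algebra_simps)

text \<open>For \<open>x < 0\<close> both weights on the right are positive.\<close>

lemma poly_tri_eulerian_Suc:
  "(1 - x) * poly (tri_eulerian a (Suc b) c) x =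
     poly (tri_eulerian a b (Suc c)) x + (- x) * poly (tri_eulerian (Suc a) b c) x"
  unfolding tri_eulerian.simps poly_add using poly_tri_eulerian_diff[of x a b c] by algebra

text \<open>For \<open>c = 0\<close> the argument of \<open>L\<close> does not involve
  \<open>x\<close>, so \<open>L\<close> acts as the transform. The base case needs that
  \<open>x A_a\<close> is the last entry \<open>first_letter_eulerian a a\<close>.\<close>

lemma eulerian_transform_tri_eulerian:
  "eulerian_transform ([:0, 1:] ^ a * [:1, 1:] ^ b) = tri_eulerian a b 0"
proof (induction b arbitrary: a)
  case 0
  show ?case
  proof (cases a)
    case 0
    thus ?thesis by (simp add: eulerian_transform_1)
  next
    case (Suc m)
    have "eulerian_transform ([:0, 1:] ^ a) = [:0, 1:] * first_letter_eulerian a 0"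
      using eulerian_transform_monom[of a] Suc
      by (simp add: monom_altdef eulerian_poly_eq del: first_letter_eulerian.simps)
    thus ?thesis using first_letter_eulerian_last[of m] Suc
      by (simp del: first_letter_eulerian.simps)
  qed
next
  case (Suc b)
  have "[:0, 1:] ^ a * [:1, 1:] ^ Suc b =
      [:0, 1:] ^ Suc a * [:1, 1:] ^ b + [:0, 1:] ^ a * [:1, 1:: real:] ^ b"
  proof -
    have "[:1, 1::real:] = [:0, 1:] + 1" by (simp add: one_pCons)
    thus ?thesis by (simp only: power_Suc distrib_left distrib_right mult_1_left mult.left_commute mult.assoc)
  qed
  thus ?case by (simp only: eulerian_transform_add Suc tri_eulerian.simps)
qed

lemma degree_tri_eulerian: "degree (tri_eulerian a b c) \<le> a + b + c"
proof (induction b arbitrary: a)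
  case 0
  show ?case using degree_first_letter_eulerian[of "a + c" a] by simp
next
  case (Suc b)
  show ?case using Suc[of a] Suc[of "Suc a"] by (auto intro!: degree_add_le)
qed

lemma coeff_tri_eulerian_top: "coeff (tri_eulerian a b 0) (a + b) = 1"
proof (induction b arbitrary: a)
  case 0
  show ?case using coeff_first_letter_eulerian_top[of a a] by simp
next
  case (Suc b)
  have "coeff (tri_eulerian a b 0) (a + Suc b) = 0"
    using degree_tri_eulerian[of a b 0] by (intro coeff_eq_0) simp
  thus ?case using Suc[of "Suc a"] by simp
qed

lemma poly_tri_eulerian_0: "poly (tri_eulerian a b 0) 0 = (if a = 0 then 1 else 0)"
proof (induction b arbitrary: a)
  case 0
  show ?case using poly_first_letter_eulerian_0[of a a] by simp
qed simp

section \<open>Signs in the triangle of weighted averages\<close>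

context
  fixes x s :: real
  assumes x: "x < 0"
begin

lemma tri_eulerian_pos_comb:
  assumes "s * poly (tri_eulerian a b (Suc c)) x \<ge> 0" "s * poly (tri_eulerian (Suc a) b c) x \<ge> 0"
  shows "s * poly (tri_eulerian a (Suc b) c) x \<ge> 0"
    and "s * poly (tri_eulerian a b (Suc c)) x > 0 \<or> s * poly (tri_eulerian (Suc a) b c) x > 0 \<Longrightarrow>
      s * poly (tri_eulerian a (Suc b) c) x > 0"
proof -
  have eq: "(1 - x) * (s * poly (tri_eulerian a (Suc b) c) x) =
      s * poly (tri_eulerian a b (Suc c)) x + (- x) * (s * poly (tri_eulerian (Suc a) b c) x)"
    using arg_cong[OF poly_tri_eulerian_Suc[of x a b c], of "\<lambda>y. s * y"]
    by (simp only: distrib_left mult.left_commute)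
  have "(- x) * (s * poly (tri_eulerian (Suc a) b c) x) \<ge> 0"
    by (rule mult_nonneg_nonneg) (use assms(2) x in linarith)+
  hence "(1 - x) * (s * poly (tri_eulerian a (Suc b) c) x) \<ge> 0" using eq assms(1) by linarith
  thus "s * poly (tri_eulerian a (Suc b) c) x \<ge> 0"
    using x by (simp only: zero_le_mult_iff) auto
  assume "s * poly (tri_eulerian a b (Suc c)) x > 0 \<or> s * poly (tri_eulerian (Suc a) b c) x > 0"
  hence "(1 - x) * (s * poly (tri_eulerian a (Suc b) c) x) > 0"
  proof
    assume "s * poly (tri_eulerian (Suc a) b c) x > 0"
    hence "(- x) * (s * poly (tri_eulerian (Suc a) b c) x) > 0"
      by (intro mult_pos_pos[of "- x"]) (use x in linarith)+
    thus ?thesis using eq assms(1) by linarith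
  qed (use eq \<open>(- x) * (s * poly (tri_eulerian (Suc a) b c) x) \<ge> 0\<close> in linarith)
  thus "s * poly (tri_eulerian a (Suc b) c) x > 0"
    using x by (simp only: zero_less_mult_iff) auto
qed

end

text \<open>In row \<open>b = 0\<close> only the two end entries vanish, and averaging keeps signs.
  An average could vanish only if both its neighbours were such end entries, which would need
  \<open>N = 1\<close>.\<close>

lemma tri_eulerian_pos_corner:
  assumes x: "x < 0" and h: "poly (first_letter_eulerian N 0) x = 0"
    and pos: "\<And>j. 0 < j \<Longrightarrow> j < N \<Longrightarrow> s * poly (first_letter_eulerian N j) x > 0"
    and N: "a + b + c = N" "N \<ge> 2"
  shows "s * poly (tri_eulerian a b c) x \<ge> 0 \<and>
    (b = 0 \<and> (a = 0 \<or> c = 0) \<or> s * poly (tri_eulerian a b c) x > 0)"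
  using N(1)
proof (induction b arbitrary: a c)
  case 0
  have "poly (first_letter_eulerian N N) x = 0"
    using poly_first_letter_eulerian_final[of "N - 1" x] h N(2) by (simp del: first_letter_eulerian.simps)
  thus ?case using 0 h pos[of a] N(2)
    by (cases "a = 0"; cases "c = 0") (auto simp del: first_letter_eulerian.simps intro: less_imp_le)
next
  case (Suc b)
  let ?u = "s * poly (tri_eulerian a b (Suc c)) x" and ?v = "s * poly (tri_eulerian (Suc a) b c) x"
  have 1: "?u \<ge> 0" "?v \<ge> 0" using Suc.IH[of a "Suc c"] Suc.IH[of "Suc a" c] Suc.prems by auto
  have "?u > 0 \<or> ?v > 0"
  proof (rule ccontr)
    assume "\<not> ?thesis"
    hence "b = 0" "a = 0" "c = 0"
      using Suc.IH[of a "Suc c"] Suc.IH[of "Suc a" c] Suc.prems by auto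
    thus False using Suc.prems N(2) by simp
  qed
  thus ?case using tri_eulerian_pos_comb[OF x 1] by auto
qed

text \<open>For fixed \<open>b\<close> the entries form a row indexed by \<open>a\<close>, and row
  \<open>Suc b\<close> averages neighbours. If an average is nonpositive, the right one of its two
  terms is negative, hence so is the term after it, and so is the next average.\<close>

lemma down_crossing_tri_eulerian:
  assumes x: "x < 0" and dc: "down_crossing N (\<lambda>j. s * poly (first_letter_eulerian N j) x)"
    and "a + b + Suc c = N" "s * poly (tri_eulerian a b (Suc c)) x \<le> 0"
  shows "s * poly (tri_eulerian (Suc a) b c) x < 0"
  using assms(3,4)
proof (induction b arbitrary: a c)
  case 0
  thus ?case using dc[unfolded down_crossing_def, rule_format, of a]
    by (simp del: first_letter_eulerian.simps)
next
  case (Suc b)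
  have 1: "s * poly (tri_eulerian (Suc a) b (Suc c)) x < 0"
  proof (rule ccontr)
    assume n: "\<not> ?thesis"
    hence "s * poly (tri_eulerian a b (Suc (Suc c))) x > 0"
      using Suc.IH[of a "Suc c"] Suc.prems(1) by force
    hence "s * poly (tri_eulerian a (Suc b) (Suc c)) x > 0"
      using n by (intro tri_eulerian_pos_comb(2)[OF x]) auto
    thus False using Suc.prems by simp
  qed
  hence "s * poly (tri_eulerian (Suc (Suc a)) b c) x < 0"
    using Suc.IH[of "Suc a" c] Suc.prems by simp
  hence "(- s) * poly (tri_eulerian (Suc a) (Suc b) c) x > 0"
    using 1 by (intro tri_eulerian_pos_comb(2)[OF x]) auto
  thus ?case by simp
qed

text \<open>Descent from the apex \<open>b = N\<close>: were the left end of row \<open>b\<close>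
  nonpositive, its neighbour would be negative, and so would their average, the left end of row
  \<open>Suc b\<close>.\<close>

lemma tri_eulerian_first_pos:
  assumes x: "x < 0" and dc: "down_crossing N (\<lambda>j. s * poly (first_letter_eulerian N j) x)"
    and B: "s * poly (tri_eulerian 0 N 0) x \<ge> 0" and "b < N"
  shows "s * poly (tri_eulerian 0 b (N - b)) x > 0"
proof -
  have descend: "s * poly (tri_eulerian 0 b (N - b)) x > 0"
    if "s * poly (tri_eulerian 0 (Suc b) (N - Suc b)) x \<ge> 0" and lt: "b < N" for b
  proof (rule ccontr)
    assume n: "\<not> ?thesis"
    obtain c where c: "N - b = Suc c" "N - Suc b = c" "N = b + Suc c" 
      using lt by (metis Suc_diff_Suc le_add_diff_inverse less_imp_le_nat)
    have "s * poly (tri_eulerian (Suc 0) b c) x < 0"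
      using down_crossing_tri_eulerian[OF x dc, of 0 b c] n c by simp
    hence "(- s) * poly (tri_eulerian 0 (Suc b) c) x > 0"
      using n c by (intro tri_eulerian_pos_comb(2)[OF x]) auto
    thus False using that c by simp
  qed
  have weak: "s * poly (tri_eulerian 0 b (N - b)) x \<ge> 0" if "b \<le> N" for b
    using that
  proof (induction rule: inc_induct)
    case base
    show ?case using B by simp
  next
    case (step k)
    thus ?case using descend[of k] by (simp del: tri_eulerian.simps)
  qed
  show ?thesis using descend[OF weak[of "Suc b"]] \<open>b < N\<close> by simp
qed

text \<open>The mirror image, along the right ends of the rows.\<close>

lemma tri_eulerian_last_neg:
  assumes x: "x < 0" and dc: "down_crossing N (\<lambda>j. s * poly (first_letter_eulerian N j) x)"
    and B: "s * poly (tri_eulerian 0 N 0) x \<le> 0" and "b < N"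
  shows "s * poly (tri_eulerian (N - b) b 0) x < 0"
proof -
  have descend: "s * poly (tri_eulerian (N - b) b 0) x < 0"
    if "s * poly (tri_eulerian (N - Suc b) (Suc b) 0) x \<le> 0" and lt: "b < N" for b
  proof (rule ccontr)
    assume n: "\<not> ?thesis"
    obtain a where a: "N - b = Suc a" "N - Suc b = a" "N = b + Suc a" 
      using lt by (metis Suc_diff_Suc le_add_diff_inverse less_imp_le_nat)
    have "s * poly (tri_eulerian a b (Suc 0)) x > 0"
      using down_crossing_tri_eulerian[OF x dc, of a b 0] n a by force
    hence "s * poly (tri_eulerian a (Suc b) 0) x > 0"
      using n a by (intro tri_eulerian_pos_comb(2)[OF x]) auto
    thus False using that a by simp
  qed
  have weak: "s * poly (tri_eulerian (N - b) b 0) x \<le> 0" if "b \<le> N" for b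
    using that
  proof (induction rule: inc_induct)
    case base
    show ?case using B by simp
  next
    case (step k)
    thus ?case using descend[of k] by (simp del: tri_eulerian.simps)
  qed
  show ?thesis using descend[OF weak[of "Suc b"]] \<open>b < N\<close> by simp
qed

section \<open>Roots of Eulerian and binomial Eulerian polynomials\<close>

declare first_letter_eulerian.simps(2) [simp del] tri_eulerian.simps(2) [simp del]

lemma alternating_roots:
  fixes f :: "real poly"
  assumes "\<And>i. i < m \<Longrightarrow> Y (Suc i) \<le> Y i" "\<And>i. i \<le> m \<Longrightarrow> (-1) ^ i * poly f (Y i) \<ge> 0"
  shows "\<exists>Z. \<forall>i<m. Y (Suc i) \<le> Z i \<and> Z i \<le> Y i \<and> poly f (Z i) = 0"
proof -
  have "\<exists>z. Y (Suc i) \<le> z \<and> z \<le> Y i \<and> poly f z = 0" if "i < m" for i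
    using assms(1)[of i] assms(2)[of i] assms(2)[of "Suc i"] that
    by (intro poly_root_between[where s = "(-1) ^ i"]) auto
  thus ?thesis by metis
qed

text \<open>The leading term supplies the last sign change far to the left, so \<open>m\<close>
  sample points suffice for \<open>m\<close> roots.\<close>

lemma alternating_roots_unbounded:
  fixes f :: "real poly"
  assumes "lead_coeff f > 0" "degree f = m"
    "\<And>i. Suc i < m \<Longrightarrow> Y (Suc i) \<le> Y i" "\<And>i. i < m \<Longrightarrow> (-1) ^ i * poly f (Y i) \<ge> 0"
  shows "\<exists>Z. \<forall>i<m. (Suc i < m \<longrightarrow> Y (Suc i) \<le> Z i) \<and> Z i \<le> Y i \<and> poly f (Z i) = 0"
proof -
  obtain y where y: "y < Y (m - 1)" "(-1) ^ m * poly f y > 0"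
    using poly_alternating_infinity[OF assms(1), of "Y (m - 1)"] assms(2) by auto
  define Y' where "Y' = (\<lambda>i. if i < m then Y i else y)"
  have "\<exists>Z. \<forall>i<m. Y' (Suc i) \<le> Z i \<and> Z i \<le> Y' i \<and> poly f (Z i) = 0"
  proof (rule alternating_roots)
    show "Y' (Suc i) \<le> Y' i" if "i < m" for i
    proof (cases "Suc i < m")
      case False
      hence "i = m - 1" using that by simp
      thus ?thesis using y that by (simp add: Y'_def)
    qed (use assms in \<open>simp add: Y'_def\<close>)
    show "(-1) ^ i * poly f (Y' i) \<ge> 0" if "i \<le> m" for i
      using assms(4)[of i] y that by (cases "i = m") (auto simp: Y'_def)
  qed
  then obtain Z where Z: "\<And>i. i < m \<Longrightarrow> Y' (Suc i) \<le> Z i \<and> Z i \<le> Y' i \<and> poly f (Z i) = 0"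
    by blast
  show ?thesis
  proof (intro exI allI impI)
    show "(Suc i < m \<longrightarrow> Y (Suc i) \<le> Z i) \<and> Z i \<le> Y i \<and> poly f (Z i) = 0" if "i < m" for i
      using Z[OF that] that by (auto simp: Y'_def split: if_splits)
  qed
qed

lemma coeff_eulerian_top: "coeff (first_letter_eulerian (Suc n) 0) n = 1"
proof -
  have "coeff (first_letter_eulerian (Suc n) 0) n = (\<Sum>i=0..n. coeff (first_letter_eulerian n i) n)"
    by (simp add: coeff_sum first_letter_eulerian.simps(2))
  also have "\<dots> = (\<Sum>i=0..n. if i = n then 1 else 0)"
    by (intro sum.cong refl coeff_first_letter_eulerian_top) auto
  finally show ?thesis by simp
qed

lemma degree_eulerian: "degree (first_letter_eulerian (Suc n) 0) = n"
proof (rule antisym)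
  show "degree (first_letter_eulerian (Suc n) 0) \<le> n"
    by (auto simp: first_letter_eulerian.simps(2) intro!: degree_sum_le degree_first_letter_eulerian)
  show "n \<le> degree (first_letter_eulerian (Suc n) 0)"
    by (rule le_degree) (simp add: coeff_eulerian_top)
qed

text \<open>\<open>R\<close> lists the roots of \<open>x A_n\<close>; the root 0 in front aligns
  indices with the signs \<open>(-1) ^ i\<close>. The interior signs are carried along because the
  induction and all later sign arguments start from them.\<close>

definition eulerian_root_seq :: "nat \<Rightarrow> (nat \<Rightarrow> real) \<Rightarrow> bool" where
  "eulerian_root_seq n R \<longleftrightarrow> R 0 = 0 \<and> (\<forall>i. Suc i < n \<longrightarrow> R (Suc i) < R i) \<and>
     (\<forall>i. 0 < i \<longrightarrow> i < n \<longrightarrow> poly (first_letter_eulerian n 0) (R i) = 0 \<and>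
        (\<forall>j. 0 < j \<longrightarrow> j < n \<longrightarrow> (-1) ^ i * poly (first_letter_eulerian n j) (R i) > 0))"

lemma eulerian_root_seq_desc:
  assumes "eulerian_root_seq n R" "i < j" "j < n"
  shows "R j < R i"
  using assms(2,3)
proof (induction j)
  case (Suc j)
  have "R (Suc j) < R j" using Suc.prems assms(1) by (simp add: eulerian_root_seq_def)
  thus ?case using Suc by (cases "i = j") auto
qed simp

lemma eulerian_root_seq_neg:
  assumes "eulerian_root_seq n R" "0 < j" "j < n"
  shows "R j < 0"
  using eulerian_root_seq_desc[OF assms] assms(1) by (simp add: eulerian_root_seq_def)

text \<open>The roots to the right of \<open>y\<close> are exactly \<open>R 1, ..., R i\<close>; for
  \<open>i = n\<close> these are all of them.\<close>

lemma eulerian_sign_between: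
  assumes R: "eulerian_root_seq (Suc n) R" and i: "i \<le> n" "y < R i" "i < n \<Longrightarrow> R (Suc i) < y"
  shows "(-1) ^ i * poly (first_letter_eulerian (Suc n) 0) y > 0"
proof (rule strict_desc_roots_sign[where n = n and z = "\<lambda>i. R (Suc i)"])
  have 1: "coeff (first_letter_eulerian (Suc n) 0) n = 1" by (rule coeff_eulerian_top)
  show "strict_desc_roots (first_letter_eulerian (Suc n) 0) n (\<lambda>i. R (Suc i))"
  proof (rule strict_desc_rootsI)
    show "first_letter_eulerian (Suc n) 0 \<noteq> 0" using 1 by fastforce
  qed (use R degree_eulerian[of n] in \<open>simp_all add: eulerian_root_seq_def\<close>)
  show "lead_coeff (first_letter_eulerian (Suc n) 0) > 0"
    using 1 degree_eulerian[of n] by simp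
  show "y < R (Suc l)" if "l < i" for l
    using eulerian_root_seq_desc[OF R, of "Suc l" i] i that by (cases "Suc l = i") auto
  show "R (Suc l) < y" if "i \<le> l" "l < n" for l
    using eulerian_root_seq_desc[OF R, of "Suc i" "Suc l"] i that by (cases "l = i") auto
qed (use i in auto)

text \<open>The next Eulerian polynomial alternates along \<open>R\<close>, because the Sturm
  property gives it the interior sign stored there. So a new root falls into each gap and one below
  all entries; then 0 is put in front again.\<close>

lemma eulerian_root_seq_exists: "\<exists>R. eulerian_root_seq (Suc n) R"
proof (induction n)
  case 0
  show ?case by (rule exI[of _ "\<lambda>_. 0"]) (simp add: eulerian_root_seq_def)
next
  case (Suc n)
  then obtain R where R: "eulerian_root_seq (Suc n) R" by blast
  let ?f = "first_letter_eulerian (Suc (Suc n)) 0"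
  have sgn: "(-1) ^ i * poly ?f (R i) > 0" if "i < Suc n" for i
  proof (cases "i = 0")
    case True
    thus ?thesis using R poly_first_letter_eulerian_0[of 0 "Suc (Suc n)"]
      by (simp add: eulerian_root_seq_def)
  next
    case False
    hence z: "poly (first_letter_eulerian (Suc n) 0) (R i) = 0" and
      pos: "\<And>j. 0 < j \<Longrightarrow> j < Suc n \<Longrightarrow> (-1) ^ i * poly (first_letter_eulerian (Suc n) j) (R i) > 0"
      using R that by (auto simp: eulerian_root_seq_def)
    have "R i < 0" using eulerian_root_seq_neg[OF R] False that by simp
    note pat = sign_pattern_first_letter_eulerian[OF this, of "Suc n", THEN conjunct2, rule_format, OF z]
    have "(-1) ^ i * poly (first_letter_eulerian (Suc n) 1) (R i) > 0"
      using pos pat by simp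
    moreover have "sgn (poly (first_letter_eulerian n 0) (R i)) * poly (first_letter_eulerian (Suc n) 1) (R i) < 0"
      using pat by simp
    moreover have "poly ?f (R i) * poly (first_letter_eulerian n 0) (R i) < 0"
      using pat by simp
    ultimately show ?thesis
      by (auto simp: sgn_if mult_less_0_iff zero_less_mult_iff split: if_splits)
  qed
  have "\<exists>Z. \<forall>i<Suc n. (Suc i < Suc n \<longrightarrow> R (Suc i) \<le> Z i) \<and> Z i \<le> R i \<and> poly ?f (Z i) = 0"
    by (rule alternating_roots_unbounded)
       (use coeff_eulerian_top[of "Suc n"] degree_eulerian[of "Suc n"] sgn R in
        \<open>auto simp: eulerian_root_seq_def intro: less_imp_le\<close>)
  then obtain Z where Z: "\<And>i. i < n \<Longrightarrow> R (Suc i) \<le> Z i" "\<And>i. i < Suc n \<Longrightarrow> Z i \<le> R i"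
      "\<And>i. i < Suc n \<Longrightarrow> poly ?f (Z i) = 0"
    by (metis Suc_less_eq less_SucI)
  have ne: "Z k \<noteq> R i" if "i < Suc n" "k < Suc n" for i k using sgn[OF that(1)] Z(3)[OF that(2)] by auto
  have Zlt: "Z i < R i" if "i < Suc n" for i using Z(2)[OF that] ne[OF that that] by simp
  have Zgt: "R (Suc i) < Z i" if "i < n" for i using Z(1)[OF that] ne[of "Suc i" i] that by simp
  define R' where "R' = (\<lambda>i. if i = 0 then 0 else Z (i - 1))"
  have "eulerian_root_seq (Suc (Suc n)) R'"
    unfolding eulerian_root_seq_def
  proof (intro conjI allI impI)
    show "R' 0 = 0" by (simp add: R'_def)
    show "R' (Suc i) < R' i" if "Suc i < Suc (Suc n)" for i
    proof (cases i)
      case 0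
      thus ?thesis using Zlt[of 0] R by (simp add: R'_def eulerian_root_seq_def)
    next
      case (Suc k)
      thus ?thesis using Zlt[of i] Zgt[of k] that by (simp add: R'_def)
    qed
    fix i assume i: "0 < i" "i < Suc (Suc n)"
    then obtain k where k: "i = Suc k" "k \<le> n" by (cases i) auto
    show z: "poly ?f (R' i) = 0" using Z(3)[of k] k by (simp add: R'_def)
    fix j assume j: "0 < j" "j < Suc (Suc n)"
    \<comment> \<open>The old polynomial has a known sign between old roots, and the interior values
      at a new root have the opposite one.\<close>
    have s: "(-1) ^ k * poly (first_letter_eulerian (Suc n) 0) (R' i) > 0"
      by (rule eulerian_sign_between[OF R]) (use k Zlt[of k] Zgt[of k] in \<open>auto simp: R'_def\<close>)
    have "R k \<le> 0" using eulerian_root_seq_neg[OF R, of k] R k by (cases "k = 0") (auto simp: eulerian_root_seq_def)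
    hence "R' i < 0" using Zlt[of k] k by (simp add: R'_def)
    note pat = sign_pattern_first_letter_eulerian[OF this, of "Suc (Suc n)", THEN conjunct2, rule_format, OF z]
    have "sgn (poly (first_letter_eulerian (Suc n) 0) (R' i)) *
        poly (first_letter_eulerian (Suc (Suc n)) j) (R' i) < 0"
      using pat j by simp
    thus "(-1) ^ i * poly (first_letter_eulerian (Suc (Suc n)) j) (R' i) > 0"
      using s k by (auto simp: sgn_if mult_less_0_iff zero_less_mult_iff split: if_splits)
  qed
  thus ?case by blast
qed

lemma strict_desc_roots_x_eulerian:
  assumes "eulerian_root_seq (Suc n) R"
  shows "strict_desc_roots ([:0, 1:] * eulerian_poly (Suc n)) (Suc n) R"
proof (rule strict_desc_rootsI)
  let ?f = "[:0, 1:] * eulerian_poly (Suc n)"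
  show "?f \<noteq> 0" using coeff_eulerian_top[of n] by (auto simp: eulerian_poly_eq)
  show "degree ?f \<le> Suc n"
    using degree_eulerian[of n] by (simp add: eulerian_poly_eq degree_pCons_le)
  show "poly ?f (R i) = 0" if "i < Suc n" for i
    using assms that by (cases "i = 0")
      (auto simp: eulerian_poly_eq eulerian_root_seq_def)
qed (use assms in \<open>simp add: eulerian_root_seq_def\<close>)

lemma tri_eulerian_sign_at_eulerian_root:
  assumes R: "eulerian_root_seq n R" and i: "0 < i" "i < n" and "a + b + c = n"
  shows "(-1) ^ i * poly (tri_eulerian a b c) (R i) \<ge> 0"
    and "b > 0 \<Longrightarrow> (-1) ^ i * poly (tri_eulerian a b c) (R i) > 0"
  using tri_eulerian_pos_corner[of "R i" n "(-1) ^ i" a b c] eulerian_root_seq_neg[OF R i]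
    R i assms(4) by (auto simp: eulerian_root_seq_def)

text \<open>The transform of \<open>(1+x)^(n+1)\<close> is monic and alternates strictly along
  \<open>R\<close>.\<close>

lemma binomial_eulerian_roots:
  assumes R: "eulerian_root_seq (Suc n) R"
  shows "\<exists>T. strict_desc_roots (tri_eulerian 0 (Suc n) 0) (Suc n) T \<and> (\<forall>i\<le>n. T i < R i) \<and>
     (\<forall>i<n. R (Suc i) < T i)"
proof -
  let ?B = "tri_eulerian 0 (Suc n) 0"
  have co: "coeff ?B (Suc n) = 1" using coeff_tri_eulerian_top[of 0 "Suc n"] by simp
  have "degree ?B \<le> Suc n" using degree_tri_eulerian[of 0 "Suc n" 0] by simp
  moreover have "Suc n \<le> degree ?B" by (rule le_degree) (simp add: co)
  ultimately have deg: "degree ?B = Suc n" by simp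
  have sgn: "(-1) ^ i * poly ?B (R i) > 0" if "i < Suc n" for i
  proof (cases "i = 0")
    case True
    thus ?thesis using R poly_tri_eulerian_0[of 0 "Suc n"] by (simp add: eulerian_root_seq_def)
  qed (use tri_eulerian_sign_at_eulerian_root[OF R, of i] that in auto)
  have "\<exists>Z. \<forall>i<Suc n. (Suc i < Suc n \<longrightarrow> R (Suc i) \<le> Z i) \<and> Z i \<le> R i \<and> poly ?B (Z i) = 0"
    by (rule alternating_roots_unbounded)
       (use co deg sgn R in \<open>auto simp: eulerian_root_seq_def intro: less_imp_le\<close>)
  then obtain Z where Z: "\<And>i. i < n \<Longrightarrow> R (Suc i) \<le> Z i" "\<And>i. i < Suc n \<Longrightarrow> Z i \<le> R i"
      "\<And>i. i < Suc n \<Longrightarrow> poly ?B (Z i) = 0"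
    by (metis Suc_less_eq less_SucI)
  have ne: "Z k \<noteq> R i" if "i < Suc n" "k < Suc n" for i k using sgn[OF that(1)] Z(3)[OF that(2)] by auto
  have Zlt: "Z i < R i" if "i \<le> n" for i using Z(2)[of i] ne[of i i] that by simp
  have Zgt: "R (Suc i) < Z i" if "i < n" for i using Z(1)[OF that] ne[of "Suc i" i] that by simp
  have "strict_desc_roots ?B (Suc n) Z"
  proof (rule strict_desc_rootsI)
    show "?B \<noteq> 0" using co by fastforce
    show "Z (Suc i) < Z i" if "Suc i < Suc n" for i using Zlt[of "Suc i"] Zgt[of i] that by simp
  qed (use deg Z in auto)
  thus ?thesis using Zlt Zgt by blast
qed

text \<open>Between entries of \<open>R\<close> the row \<open>b = 0\<close> is down-crossing up to
  the factor \<open>(-1) ^ i\<close>. As the apex vanishes at \<open>t\<close>, the arguments for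
  left ends and for right ends both apply.\<close>

lemma tri_eulerian_sign_at_binomial_root:
  assumes R: "eulerian_root_seq (Suc n) R" and i: "i \<le> n" "t < R i" "i < n \<Longrightarrow> R (Suc i) < t"
    and B: "poly (tri_eulerian 0 (Suc n) 0) t = 0" and k: "k \<le> n"
  shows "(-1) ^ i * poly (tri_eulerian (Suc n - k) k 0) t < 0"
    and "(-1) ^ i * poly (tri_eulerian 0 k (Suc n - k)) t > 0"
proof -
  have pos: "(-1) ^ i * poly (first_letter_eulerian (Suc n) 0) t > 0"
    by (rule eulerian_sign_between[OF R i])
  have "R i \<le> 0" using eulerian_root_seq_neg[OF R, of i] R i by (cases "i = 0") (auto simp: eulerian_root_seq_def)
  hence t: "t < 0" using i by simp
  have "sgn (poly (first_letter_eulerian (Suc n) 0) t) = (-1) ^ i"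
    using pos by (cases "even i") (auto simp: sgn_if)
  hence dc: "down_crossing (Suc n) (\<lambda>j. (-1) ^ i * poly (first_letter_eulerian (Suc n) j) t)"
    using sign_pattern_first_letter_eulerian[OF t, of "Suc n"] pos
    by auto
  show "(-1) ^ i * poly (tri_eulerian (Suc n - k) k 0) t < 0"
    by (rule tri_eulerian_last_neg[OF t dc]) (use B k in auto)
  show "(-1) ^ i * poly (tri_eulerian 0 k (Suc n - k)) t > 0"
    by (rule tri_eulerian_first_pos[OF t dc]) (use B k in auto)
qed

section \<open>Gamma-positivity of the symmetric decomposition\<close>

text \<open>Gamma-positive polynomials form the convex cone spanned by the basis, which gives an
  induction rule.\<close>

lemma gamma_positive_cone [consumes 1, case_names zero add smult basis]:
  assumes "gamma_positive m f" "P 0" "\<And>f g. P f \<Longrightarrow> P g \<Longrightarrow> P (f + g)"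
    "\<And>c f. c \<ge> 0 \<Longrightarrow> P f \<Longrightarrow> P (smult c f)"
    "\<And>i. 2 * i \<le> m \<Longrightarrow> P ([:0, 1:] ^ i * [:1, 1:] ^ (m - 2 * i))"
  shows "P f"
proof -
  obtain \<gamma> where g: "\<And>i. i \<le> m div 2 \<Longrightarrow> \<gamma> i \<ge> 0"
    and f: "f = (\<Sum>i\<le>m div 2. smult (\<gamma> i) ([:0, 1:] ^ i * [:1, 1:] ^ (m - 2 * i)))"
    using assms(1) unfolding gamma_positive_def by blast
  have "P (\<Sum>i\<in>A. smult (\<gamma> i) ([:0, 1:] ^ i * [:1, 1:] ^ (m - 2 * i)))" if "A \<subseteq> {..m div 2}" for A
    using finite_subset[OF that] that
    by (induction A rule: finite_induct)
       (auto simp del: mult_pCons_left mult_pCons_right intro!: assms(2-5) g)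
  thus ?thesis using f by blast
qed

lemma gamma_positive_0: "gamma_positive m 0"
  unfolding gamma_positive_def by (rule exI[of _ "\<lambda>_. 0"]) simp

lemma gamma_positive_add:
  assumes "gamma_positive m f" "gamma_positive m g"
  shows "gamma_positive m (f + g)"
proof -
  obtain \<gamma> \<delta> where "\<forall>i\<le>m div 2. \<gamma> i \<ge> 0" "\<forall>i\<le>m div 2. \<delta> i \<ge> 0"
    "f = (\<Sum>i\<le>m div 2. smult (\<gamma> i) ([:0, 1:] ^ i * [:1, 1:] ^ (m - 2 * i)))"
    "g = (\<Sum>i\<le>m div 2. smult (\<delta> i) ([:0, 1:] ^ i * [:1, 1:] ^ (m - 2 * i)))"
    using assms unfolding gamma_positive_def by blast
  thus ?thesis unfolding gamma_positive_def
    by (intro exI[of _ "\<lambda>i. \<gamma> i + \<delta> i"]) (simp add: smult_add_left sum.distrib)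
qed

lemma gamma_positive_smult:
  assumes "gamma_positive m f" "c \<ge> 0"
  shows "gamma_positive m (smult c f)"
proof -
  obtain \<gamma> where "\<forall>i\<le>m div 2. \<gamma> i \<ge> 0"
    "f = (\<Sum>i\<le>m div 2. smult (\<gamma> i) ([:0, 1:] ^ i * [:1, 1:] ^ (m - 2 * i)))"
    using assms unfolding gamma_positive_def by blast
  thus ?thesis unfolding gamma_positive_def using assms(2)
    by (intro exI[of _ "\<lambda>i. c * \<gamma> i"]) (simp add: smult_sum_poly)
qed

lemma gamma_positive_sum:
  assumes "\<And>i. i \<in> A \<Longrightarrow> gamma_positive m (f i)"
  shows "gamma_positive m (\<Sum>i\<in>A. f i)"
  using assms by (induction A rule: infinite_finite_induct) (auto intro: gamma_positive_0 gamma_positive_add)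

lemma gamma_positive_basis:
  assumes "2 * i \<le> m"
  shows "gamma_positive m ([:0, 1:] ^ i * [:1, 1:] ^ (m - 2 * i))"
  unfolding gamma_positive_def
proof (intro exI[of _ "\<lambda>j. if j = i then 1 else 0"] conjI)
  have "(\<Sum>j\<le>m div 2. smult (if j = i then 1 else 0) ([:0, 1:] ^ j * [:1, 1:] ^ (m - 2 * j))) =
      (\<Sum>j\<le>m div 2. if j = i then [:0, 1:] ^ j * [:1, 1::real:] ^ (m - 2 * j) else 0)"
    by (rule sum.cong) auto
  also have "\<dots> = [:0, 1:] ^ i * [:1, 1:] ^ (m - 2 * i)"
    using assms by (subst sum.delta) auto
  finally show "[:0, 1:] ^ i * [:1, 1::real:] ^ (m - 2 * i) =
    (\<Sum>j\<le>m div 2. smult (if j = i then 1 else 0) ([:0, 1:] ^ j * [:1, 1:] ^ (m - 2 * j)))" ..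
qed auto

lemma gamma_positive_mult_x:
  assumes "gamma_positive m f"
  shows "gamma_positive (Suc (Suc m)) ([:0, 1:] * f)"
  using assms
proof (induction rule: gamma_positive_cone)
  case (basis i)
  have "gamma_positive (Suc (Suc m)) ([:0, 1:] ^ Suc i * [:1, 1:] ^ (Suc (Suc m) - 2 * Suc i))"
    using basis by (intro gamma_positive_basis) auto
  thus ?case by (simp only: power_Suc mult.assoc) simp
qed (simp_all only: distrib_left mult_smult_right mult_zero_right
      gamma_positive_0 gamma_positive_add gamma_positive_smult)

lemma gamma_positive_mult_1x:
  assumes "gamma_positive m f"
  shows "gamma_positive (Suc m) ([:1, 1:] * f)"
  using assms
proof (induction rule: gamma_positive_cone)
  case (basis i)
  have "gamma_positive (Suc m) ([:0, 1:] ^ i * [:1, 1:] ^ (Suc m - 2 * i))"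
    using basis by (intro gamma_positive_basis) auto
  also have "Suc m - 2 * i = Suc (m - 2 * i)" using basis by simp
  finally show ?case by (simp only: power_Suc mult.left_commute)
qed (simp_all only: distrib_left mult_smult_right mult_zero_right
      gamma_positive_0 gamma_positive_add gamma_positive_smult)

lemma coeff_gamma_basis:
  "coeff ([:0, 1:] ^ i * [:1, 1::real:] ^ N) j = (if j < i then 0 else of_nat (N choose (j - i)))"
proof -
  have "coeff ([:1, 1::real:] ^ N) k = of_nat (N choose k)" for k
    using coeff_linear_poly_power[of k N 1 "1::real"] coeff_eq_0[of "[:1, 1::real:] ^ N" k]
    by (cases "k \<le> N") (simp_all add: degree_power_eq)
  thus ?thesis by (simp add: monom_altdef[of 1, simplified, symmetric] coeff_monom_mult)
qed

text \<open>Unimodality alone is not preserved by sums; symmetry with growth up to the fixed index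
  \<open>m div 2\<close> is, and shifted binomial rows have it.\<close>

lemma gamma_positive_shape:
  assumes "gamma_positive m f"
  shows "degree f \<le> m \<and> (\<forall>i. coeff f i \<ge> 0) \<and> (\<forall>i\<le>m. coeff f i = coeff f (m - i)) \<and>
    (\<forall>i<m div 2. coeff f i \<le> coeff f (Suc i))"
  using assms
proof (induction rule: gamma_positive_cone)
  case (add f g)
  hence nonneg: "\<And>i. coeff f i \<ge> 0" "\<And>i. coeff g i \<ge> 0"
    and mono: "\<And>i. i < m div 2 \<Longrightarrow> coeff f i \<le> coeff f (Suc i)"
      "\<And>i. i < m div 2 \<Longrightarrow> coeff g i \<le> coeff g (Suc i)"
    and deg: "degree f \<le> m" "degree g \<le> m" by blast+
  show ?case
  proof (intro conjI allI impI)
    show "coeff (f + g) i = coeff (f + g) (m - i)" if "i \<le> m" for i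
      using add that by (metis coeff_add)
    show "coeff (f + g) i \<le> coeff (f + g) (Suc i)" if "i < m div 2" for i
      unfolding coeff_add by (intro add_mono mono that)
    show "coeff (f + g) i \<ge> 0" for i
      unfolding coeff_add by (intro add_nonneg_nonneg nonneg)
  qed (intro degree_add_le deg)
next
  case (smult c f)
  hence nonneg: "\<And>i. coeff f i \<ge> 0"
    and mono: "\<And>i. i < m div 2 \<Longrightarrow> coeff f i \<le> coeff f (Suc i)"
    and deg: "degree f \<le> m" by blast+
  show ?case
  proof (intro conjI allI impI)
    show "coeff (smult c f) i = coeff (smult c f) (m - i)" if "i \<le> m" for i
      using smult that by (metis coeff_smult)
    show "coeff (smult c f) i \<le> coeff (smult c f) (Suc i)" if "i < m div 2" for i
      unfolding coeff_smult by (intro mult_left_mono mono that smult(1))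
    show "coeff (smult c f) i \<ge> 0" for i
      unfolding coeff_smult by (intro mult_nonneg_nonneg nonneg smult(1))
  qed (rule order.trans[OF degree_smult_le deg])
next
  case (basis i)
  define N where "N = m - 2 * i"
  have m: "m = N + 2 * i" using basis by (simp add: N_def)
  have "degree ([:0, 1:] ^ i * [:1, 1::real:] ^ N) \<le> m"
    by (rule order.trans[OF degree_mult_le]) (simp add: degree_power_eq m)
  moreover have "coeff ([:0, 1:] ^ i * [:1, 1::real:] ^ N) j =
      coeff ([:0, 1:] ^ i * [:1, 1:] ^ N) (m - j)" if "j \<le> m" for j
    unfolding coeff_gamma_basis
  proof (cases "i \<le> j \<and> j \<le> N + i")
    case True
    hence "j - i \<le> N" "m - j - i = N - (j - i)" using m by linarith+
    hence "N choose (j - i) = N choose (m - j - i)"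
      using binomial_symmetric[of "j - i" N] by simp
    thus "(if j < i then 0 else real (N choose (j - i))) =
        (if m - j < i then 0 else real (N choose (m - j - i)))" using True m by auto
  next
    case False
    hence "j < i \<or> N < j - i" "m - j < i \<or> N < m - j - i" using m that by linarith+
    thus "(if j < i then 0 else real (N choose (j - i))) =
        (if m - j < i then 0 else real (N choose (m - j - i)))"
      by (auto simp: binomial_eq_0)
  qed
  moreover have "coeff ([:0, 1:] ^ i * [:1, 1::real:] ^ N) j \<le>
      coeff ([:0, 1:] ^ i * [:1, 1:] ^ N) (Suc j)" if "j < m div 2" for j
  proof (cases "j < i")
    case False
    hence "N choose (j - i) \<le> N choose (Suc j - i)"
      using that m by (intro binomial_mono) auto
    thus ?thesis using False by (simp add: coeff_gamma_basis)
  qed (simp add: coeff_gamma_basis)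
  moreover have "coeff ([:0, 1:] ^ i * [:1, 1::real:] ^ N) j \<ge> 0" for j
    by (simp add: coeff_gamma_basis)
  ultimately show ?case unfolding N_def[symmetric] by blast
qed auto

lemma gamma_positive_imp_symmetric: "gamma_positive m f \<Longrightarrow> symmetric_poly m f"
  using gamma_positive_shape[of m f] unfolding symmetric_poly_def by blast

lemma gamma_positive_imp_nonneg: "gamma_positive m f \<Longrightarrow> nonneg_coeffs f"
  using gamma_positive_shape[of m f] unfolding nonneg_coeffs_def by blast

lemma gamma_positive_imp_unimodal:
  assumes "gamma_positive m f"
  shows "unimodal m f"
proof -
  note s = gamma_positive_shape[OF assms]
  have "coeff f (i + 1) \<le> coeff f i" if "m div 2 \<le> i" "i < m" for i
  proof -
    have eq: "coeff f (i + 1) = coeff f (m - (i + 1))" "coeff f i = coeff f (m - i)"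
      using s that by (metis Suc_eq_plus1 Suc_leI less_imp_le)+
    show ?thesis
    proof (cases "m - (i + 1) < m div 2")
      case True
      hence "coeff f (m - (i + 1)) \<le> coeff f (Suc (m - (i + 1)))" using s by blast
      also have "Suc (m - (i + 1)) = m - i" using that by simp
      finally show ?thesis using eq by simp
    next
      case False
      \<comment> \<open>The two middle coefficients for odd \<open>m\<close> mirror each
        other.\<close>
      hence "m - (i + 1) = i" using that by linarith
      thus ?thesis using eq by simp
    qed
  qed
  moreover have "degree f \<le> m" "\<And>i. coeff f i \<ge> 0"
      "\<And>i. i < m div 2 \<Longrightarrow> coeff f i \<le> coeff f (i + 1)"
    using s unfolding Suc_eq_plus1 by blast+
  ultimately show ?thesis unfolding unimodal_def by (intro conjI exI[of _ "m div 2"]) auto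
qed

section \<open>Decompositions of the transformed basis\<close>

text \<open>The symmetric decomposition \<open>p = a + x b\<close> of \<open>p = tri_eulerian a k 0\<close>: as \<open>a + b\<close> is the
  reciprocal \<open>tri_eulerian 0 k a\<close> of \<open>p\<close>, the polynomial \<open>b\<close> is the difference of the two divided by \<open>1 - x\<close>.\<close>

definition dec_b :: "nat \<Rightarrow> nat \<Rightarrow> real poly" where
  "dec_b a k = (\<Sum>i<a. tri_eulerian i k (a - 1 - i))"

definition dec_a :: "nat \<Rightarrow> nat \<Rightarrow> real poly" where
  "dec_a a k = tri_eulerian 0 k a - dec_b a k"

lemma one_minus_x_mult: "[:1, -1:] * f = f - [:0, 1:] * (f :: real poly)"
  by simp

lemma one_plus_x_mult: "[:1, 1:] * f = f + [:0, 1:] * (f :: real poly)"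
  by simp

text \<open>This is the factorization of \<open>(y + 1 - x)^a - y^a\<close> with factor
  \<open>1 - x\<close>, seen through \<open>L\<close>.\<close>

lemma dec_b_telescope: "[:1, -1:] * dec_b a k = tri_eulerian 0 k a - tri_eulerian a k 0"
proof -
  have "[:1, -1:] * dec_b a k = (\<Sum>i<a. tri_eulerian i k (a - i) - tri_eulerian (Suc i) k (a - Suc i))"
    unfolding dec_b_def sum_distrib_left tri_eulerian_diff
    by (rule sum.cong) (auto simp: Suc_diff_Suc)
  also have "\<dots> = tri_eulerian 0 k a - tri_eulerian a k 0"
    using sum_lessThan_telescope'[of "\<lambda>i. tri_eulerian i k (a - i)" a] by simp
  finally show ?thesis .
qed

lemma dec_sum: "dec_a a k + [:0, 1:] * dec_b a k = tri_eulerian a k 0"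
  using dec_b_telescope[of a k] unfolding dec_a_def one_minus_x_mult by algebra

text \<open>Split off the first summand and shift the others; the remainder
  \<open>tri_eulerian 0 k a - dec_b a k\<close> is \<open>dec_a a k\<close>.\<close>

lemma dec_b_Suc: "dec_b (Suc a) k = dec_b a (Suc k) + dec_a a k"
proof -
  have "dec_b (Suc a) k = tri_eulerian 0 k a + (\<Sum>i<a. tri_eulerian (Suc i) k (a - 1 - i))"
    unfolding dec_b_def by (subst sum.lessThan_Suc_shift) simp
  moreover have "dec_b a (Suc k) = (\<Sum>i<a. tri_eulerian (Suc i) k (a - 1 - i)) + dec_b a k"
    unfolding dec_b_def by (simp add: tri_eulerian.simps(2) sum.distrib)
  ultimately show ?thesis by (simp add: dec_a_def)
qed

text \<open>Decompose both sides of the recursion for \<open>tri_eulerian\<close> and eliminate the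
  higher \<open>dec_b\<close> terms by \<open>dec_b_Suc\<close>; no subtraction remains.\<close>

lemma dec_a_Suc: "dec_a a (Suc k) = dec_a (Suc a) k + ([:0, 1:] * dec_b a k + [:1, 1:] * dec_a a k)"
  using dec_sum[of a "Suc k"] dec_sum[of "Suc a" k] dec_sum[of a k] dec_b_Suc[of a k]
  unfolding one_plus_x_mult tri_eulerian.simps(2) by algebra

lemma dec_b_0: "dec_b 0 k = 0"
  by (simp add: dec_b_def)

text \<open>The transform of \<open>x^(n+1)\<close> is \<open>x A_{n+1}\<close>, so the second
  component absorbs everything.\<close>

lemma dec_a_no_optional: "dec_a (Suc n) 0 = 0"
proof -
  have "dec_b (Suc n) 0 = (\<Sum>i<Suc n. first_letter_eulerian n i)"
    unfolding dec_b_def by (rule sum.cong) auto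
  also have "\<dots> = first_letter_eulerian (Suc n) 0"
    by (simp add: first_letter_eulerian.simps(2) lessThan_Suc_atMost atLeast0AtMost)
  finally show ?thesis by (simp add: dec_a_def)
qed

lemma gamma_positive_dec:
  "a + k = n \<Longrightarrow> gamma_positive n (dec_a a k) \<and> gamma_positive (n - 1) (dec_b a k)"
proof (induction n arbitrary: a k)
  case 0
  have "gamma_positive 0 1" using gamma_positive_basis[of 0 0] by simp
  thus ?case using 0 by (simp add: dec_a_def dec_b_0 gamma_positive_0)
next
  case (Suc n)
  \<comment> \<open>Walk along the level \<open>a + k = Suc n\<close> from its end
    \<open>a = 0\<close>, where \<open>dec_b\<close> vanishes.\<close>
  have "gamma_positive n (dec_b a k)" if "a + k = Suc n" for a k
    using that
  proof (induction a arbitrary: k)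
    case (Suc a)
    thus ?case using Suc.IH[of "Suc k"] \<open>\<And>a k. a + k = n \<Longrightarrow> _\<close>[of a k]
      by (simp add: dec_b_Suc gamma_positive_add)
  qed (simp add: dec_b_0 gamma_positive_0)
  \<comment> \<open>The same level from the other end \<open>k = 0\<close>, where
    \<open>dec_a\<close> vanishes.\<close>
  moreover have "gamma_positive (Suc n) (dec_a a k)" if "a + k = Suc n" for a k
    using that
  proof (induction k arbitrary: a)
    case 0
    thus ?case by (simp add: dec_a_no_optional gamma_positive_0)
  next
    case (Suc k)
    have IH: "gamma_positive n (dec_a a k)" "gamma_positive (n - 1) (dec_b a k)"
      using \<open>\<And>a k. a + k = n \<Longrightarrow> _\<close>[of a k] Suc.prems by auto
    \<comment> \<open>For \<open>n = 0\<close> the truncated \<open>n - 1\<close> breaks the shift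
      of the center, but then \<open>a = 0\<close> and the product is zero.\<close>
    have "gamma_positive (Suc n) ([:0, 1:] * dec_b a k)"
    proof (cases n)
      case 0
      thus ?thesis using Suc.prems by (simp add: dec_b_0 gamma_positive_0)
    qed (use gamma_positive_mult_x[OF IH(2)] in simp)
    thus ?case unfolding dec_a_Suc using Suc.IH[of "Suc a"] Suc.prems
      by (intro gamma_positive_add gamma_positive_mult_1x IH) simp_all
  qed
  ultimately show ?case using Suc.prems by simp
qed

section \<open>Interlacing\<close>

lemma eulerian_transform_sum:
  "eulerian_transform (\<Sum>i\<in>A. f i) = (\<Sum>i\<in>A. eulerian_transform (f i))"
proof (induction A rule: infinite_finite_induct)
  case (insert i A)
  thus ?case by (simp add: eulerian_transform_add)
qed (simp_all add: eulerian_transform_def)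

lemma weighted_sum_nonneg:
  fixes c u :: "nat \<Rightarrow> real"
  assumes "\<And>k. k \<le> n \<Longrightarrow> c k \<ge> 0" "\<And>k. k \<le> n \<Longrightarrow> s * u k \<ge> 0"
  shows "s * (\<Sum>k\<le>n. c k * u k) \<ge> 0"
  unfolding sum_distrib_left
proof (rule sum_nonneg)
  show "s * (c k * u k) \<ge> 0" if "k \<in> {..n}" for k
    using mult_nonneg_nonneg[OF assms(1)[of k] assms(2)[of k]] that by (simp add: mult.left_commute)
qed

lemma weighted_sum_pos:
  fixes c u :: "nat \<Rightarrow> real"
  assumes "\<And>k. k \<le> n \<Longrightarrow> c k \<ge> 0" "\<And>k. k \<le> n \<Longrightarrow> s * u k \<ge> 0"
    and "j \<le> n" "c j > 0" "s * u j > 0"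
  shows "s * (\<Sum>k\<le>n. c k * u k) > 0"
  unfolding sum_distrib_left
proof (rule sum_pos2[where i = j])
  show "s * (c k * u k) \<ge> 0" if "k \<in> {..n}" for k
    using mult_nonneg_nonneg[OF assms(1)[of k] assms(2)[of k]] that by (simp add: mult.left_commute)
  show "s * (c j * u j) > 0"
    using mult_pos_pos[OF assms(4,5)] by (simp add: mult.left_commute)
qed (use assms in auto)

lemma interlaces_0_left: "real_rooted q \<Longrightarrow> 0 \<preceq> q"
  by (simp add: interlaces_def real_rooted_def)

lemma interlaces_0_right: "real_rooted p \<Longrightarrow> p \<preceq> 0"
  by (simp add: interlaces_def real_rooted_def)

lemma interlaces_imp_real_rooted: "p \<preceq> q \<Longrightarrow> real_rooted p \<and> real_rooted q"
  by (simp add: interlaces_def)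

section \<open>Nonnegative combinations in positive degree\<close>

locale eulerian_combination =
  fixes m :: nat and c :: "nat \<Rightarrow> real" and R T :: "nat \<Rightarrow> real"
  assumes c_nonneg: "\<And>k. k \<le> Suc m \<Longrightarrow> c k \<ge> 0"
    and R: "eulerian_root_seq (Suc m) R"
    and T: "strict_desc_roots (tri_eulerian 0 (Suc m) 0) (Suc m) T"
    and T_less: "\<And>i. i \<le> m \<Longrightarrow> T i < R i"
    and T_greater: "\<And>i. i < m \<Longrightarrow> R (Suc i) < T i"
begin

definition F :: "real poly" where
  "F = (\<Sum>k\<le>Suc m. smult (c k) (tri_eulerian (Suc m - k) k 0))"

text \<open>The reciprocal polynomial \<open>x\<^sup>m\<^sup>+\<^sup>1 F(1/x)\<close>.\<close>

definition G :: "real poly" where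
  "G = (\<Sum>k\<le>Suc m. smult (c k) (tri_eulerian 0 k (Suc m - k)))"

definition A :: "real poly" where
  "A = (\<Sum>k\<le>Suc m. smult (c k) (dec_a (Suc m - k) k))"

definition B :: "real poly" where
  "B = (\<Sum>k\<le>Suc m. smult (c k) (dec_b (Suc m - k) k))"

lemma poly_F: "poly F x = (\<Sum>k\<le>Suc m. c k * poly (tri_eulerian (Suc m - k) k 0) x)"
  by (simp only: F_def poly_sum poly_smult)

lemma poly_G: "poly G x = (\<Sum>k\<le>Suc m. c k * poly (tri_eulerian 0 k (Suc m - k)) x)"
  by (simp only: G_def poly_sum poly_smult)

lemma F_eq: "F = A + [:0, 1:] * B"
proof -
  have "A + [:0, 1:] * B = (\<Sum>k\<le>Suc m. smult (c k) (dec_a (Suc m - k) k + [:0, 1:] * dec_b (Suc m - k) k))"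
    by (simp only: A_def B_def sum_distrib_left smult_add_right mult_smult_right sum.distrib)
  thus ?thesis by (simp only: dec_sum F_def)
qed

lemma G_eq: "G = A + B"
proof -
  have "A + B = (\<Sum>k\<le>Suc m. smult (c k) (dec_a (Suc m - k) k + dec_b (Suc m - k) k))"
    by (simp only: A_def B_def smult_add_right sum.distrib)
  thus ?thesis by (simp only: dec_a_def diff_add_cancel G_def)
qed

lemma gamma_A: "gamma_positive (Suc m) A"
  unfolding A_def using gamma_positive_dec[of _ _ "Suc m"] c_nonneg
  by (intro gamma_positive_sum gamma_positive_smult) auto

lemma gamma_B: "gamma_positive m B"
  unfolding B_def using gamma_positive_dec[of _ _ "Suc m"] c_nonneg
  by (intro gamma_positive_sum gamma_positive_smult) auto

lemma T_root: "i \<le> m \<Longrightarrow> poly (tri_eulerian 0 (Suc m) 0) (T i) = 0"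
  using T by (simp add: strict_desc_roots_def)

lemma T_desc: "i < j \<Longrightarrow> j \<le> m \<Longrightarrow> T j < T i"
  using T by (simp add: strict_desc_roots_def)

lemma R_nonpos: "i \<le> m \<Longrightarrow> R i \<le> 0"
  using eulerian_root_seq_neg[OF R, of i] R by (cases "i = 0") (auto simp: eulerian_root_seq_def)

lemma T_neg: "i \<le> m \<Longrightarrow> T i < 0"
  using T_less[of i] R_nonpos[of i] by simp

lemma sign_at_T:
  assumes "i \<le> m" "k \<le> m"
  shows "(- ((-1) ^ i)) * poly (tri_eulerian (Suc m - k) k 0) (T i) > 0"
    and "(-1) ^ i * poly (tri_eulerian 0 k (Suc m - k)) (T i) > 0"
  using tri_eulerian_sign_at_binomial_root[OF R assms(1) T_less[OF assms(1)] T_greater T_root assms(2)]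
    assms by auto

text \<open>At \<open>T i\<close> the terms with \<open>k \<le> m\<close> share one sign and the
  term \<open>k = Suc m\<close> vanishes.\<close>

lemma F_sign_at_T:
  assumes "i \<le> m"
  shows "(-1) ^ i * poly F (T i) \<le> 0"
proof -
  have "(- ((-1) ^ i)) * poly F (T i) \<ge> 0"
    unfolding poly_F
  proof (rule weighted_sum_nonneg)
    fix k assume "k \<le> Suc m"
    thus "(- ((-1) ^ i)) * poly (tri_eulerian (Suc m - k) k 0) (T i) \<ge> 0"
      using sign_at_T(1)[OF assms, of k] T_root[OF assms] by (cases "k = Suc m") auto
  qed (rule c_nonneg)
  thus ?thesis by simp
qed

lemma F_sign_at_R:
  assumes "i \<le> m"
  shows "(-1) ^ i * poly F (R i) \<ge> 0"
  unfolding poly_F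
proof (rule weighted_sum_nonneg)
  fix k assume k: "k \<le> Suc m"
  show "(-1) ^ i * poly (tri_eulerian (Suc m - k) k 0) (R i) \<ge> 0"
  proof (cases "i = 0")
    case True
    thus ?thesis using R poly_tri_eulerian_0[of "Suc m - k" k] by (simp add: eulerian_root_seq_def)
  qed (use tri_eulerian_sign_at_eulerian_root(1)[OF R, of i "Suc m - k" k 0] k assms in auto)
qed (rule c_nonneg)

text \<open>The intervals from \<open>T i\<close> to \<open>R i\<close> are disjoint, each contains
  a root, and there are as many as the degree permits.\<close>

lemma F_nonzero_roots:
  assumes "F \<noteq> 0"
  shows "\<exists>P. strict_desc_roots F (Suc m) P \<and> (\<forall>i\<le>m. T i \<le> P i \<and> P i \<le> R i)"
proof -
  have "\<exists>z. T i \<le> z \<and> z \<le> R i \<and> poly F z = 0" if "i \<le> m" for i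
    using F_sign_at_T[OF that] F_sign_at_R[OF that] T_less[OF that]
    by (intro poly_root_between[where s = "(-1) ^ i"]) auto
  then obtain P where P: "\<And>i. i \<le> m \<Longrightarrow> T i \<le> P i \<and> P i \<le> R i \<and> poly F (P i) = 0" by metis
  have "degree F \<le> Suc m"
    unfolding F_def
  proof (intro degree_sum_le order.trans[OF degree_smult_le])
    show "degree (tri_eulerian (Suc m - k) k 0) \<le> Suc m" if "k \<in> {..Suc m}" for k
      using degree_tri_eulerian[of "Suc m - k" k 0] that by simp
  qed simp
  have "strict_desc_roots F (Suc m) P"
  proof (rule strict_desc_rootsI)
    show "P (Suc i) < P i" if "Suc i < Suc m" for i
      using P[of i] P[of "Suc i"] T_greater[of i] that by simp
  qed (use P assms \<open>degree F \<le> Suc m\<close> in auto)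
  thus ?thesis using P by blast
qed

lemma F_interlaces: "F \<preceq> [:0, 1:] * eulerian_poly (Suc m)" "tri_eulerian 0 (Suc m) 0 \<preceq> F"
proof -
  note XA = strict_desc_roots_x_eulerian[OF R]
  have "F \<preceq> [:0, 1:] * eulerian_poly (Suc m) \<and> tri_eulerian 0 (Suc m) 0 \<preceq> F"
  proof (cases "F = 0")
    case True
    thus ?thesis using strict_desc_roots_real_rooted[OF XA] strict_desc_roots_real_rooted[OF T]
      by (simp add: interlaces_0_left interlaces_0_right del: mult_pCons_left)
  next
    case False
    then obtain P where P: "strict_desc_roots F (Suc m) P" "\<And>i. i \<le> m \<Longrightarrow> T i \<le> P i" "\<And>i. i \<le> m \<Longrightarrow> P i \<le> R i"
      using F_nonzero_roots by blast
    have "F \<preceq> [:0, 1:] * eulerian_poly (Suc m)"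
    proof (rule strict_desc_roots_interlaces[OF P(1) XA])
      show "R (Suc i) \<le> P i" if "Suc i < Suc m" for i
        using P(2)[of i] T_greater[of i] that by simp
    qed (use P in auto)
    moreover have "tri_eulerian 0 (Suc m) 0 \<preceq> F"
    proof (rule strict_desc_roots_interlaces[OF T P(1)])
      show "P (Suc i) \<le> T i" if "Suc i < Suc m" for i
        using P(3)[of "Suc i"] T_greater[of i] that by simp
    qed (use P in auto)
    ultimately show ?thesis by simp
  qed
  thus "F \<preceq> [:0, 1:] * eulerian_poly (Suc m)" "tri_eulerian 0 (Suc m) 0 \<preceq> F" by auto
qed

lemma real_rooted_F: "real_rooted F"
  using F_interlaces(1) interlaces_imp_real_rooted by blast

lemma poly_F_eq: "poly F x = poly A x + x * poly B x"
  by (simp add: F_eq)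

lemma poly_G_eq: "poly G x = poly A x + poly B x"
  by (simp add: G_eq)

text \<open>Uses \<open>(1 - x) B = G - F\<close>. The weight \<open>c j\<close> with
  \<open>j \<le> m\<close> makes the sign of \<open>G\<close> strict, since the term
  \<open>k = Suc m\<close> vanishes at \<open>T i\<close>.\<close>

lemma B_sign_at_T:
  assumes i: "i \<le> m" and j: "j \<le> m" "c j > 0"
  shows "(-1) ^ i * poly B (T i) > 0"
proof -
  have "(-1) ^ i * poly G (T i) > 0"
    unfolding poly_G
  proof (rule weighted_sum_pos[where j = j])
    fix k assume "k \<le> Suc m"
    thus "(-1) ^ i * poly (tri_eulerian 0 k (Suc m - k)) (T i) \<ge> 0"
      using sign_at_T(2)[OF i, of k] T_root[OF i] by (cases "k = Suc m") auto
  qed (use j c_nonneg sign_at_T(2)[OF i j(1)] in auto)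
  moreover have "(1 - T i) * ((-1) ^ i * poly B (T i)) = (-1) ^ i * poly G (T i) - (-1) ^ i * poly F (T i)"
    by (simp add: poly_F_eq poly_G_eq algebra_simps)
  ultimately have "(1 - T i) * ((-1) ^ i * poly B (T i)) > 0" using F_sign_at_T[OF i] by simp
  thus ?thesis using T_neg[OF i] by (simp only: zero_less_mult_iff) auto
qed

lemma B_roots:
  assumes "j \<le> m" "c j > 0"
  shows "\<exists>W. strict_desc_roots B m W \<and> (\<forall>i<m. T (Suc i) < W i \<and> W i < T i)"
proof -
  note sgn = B_sign_at_T[OF _ assms]
  have "\<exists>Z. \<forall>i<m. T (Suc i) \<le> Z i \<and> Z i \<le> T i \<and> poly B (Z i) = 0"
    by (rule alternating_roots) (use sgn T_desc in \<open>auto intro: less_imp_le\<close>)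
  then obtain W where W: "\<And>i. i < m \<Longrightarrow> T (Suc i) \<le> W i \<and> W i \<le> T i \<and> poly B (W i) = 0" by blast
  have ne: "W k \<noteq> T i" if "i \<le> m" "k < m" for i k using sgn[OF that(1)] W[OF that(2)] by auto
  have W': "T (Suc i) < W i" "W i < T i" if "i < m" for i
    using W[OF that] ne[of "Suc i" i] ne[of i i] that by auto
  have "strict_desc_roots B m W"
  proof (rule strict_desc_rootsI)
    show "B \<noteq> 0" using sgn[of 0] by auto
    show "degree B \<le> m" using gamma_positive_shape[OF gamma_B] by blast
    show "W (Suc i) < W i" if "Suc i < m" for i using W'[of i] W'[of "Suc i"] that by simp
  qed (use W in auto)
  thus ?thesis using W' by blast
qed

text \<open>Left ends of the rows determine the sign of \<open>G\<close> if the binomial value has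
  the sign of the Eulerian one; right ends determine that of \<open>F\<close> if it has the opposite
  sign. As \<open>F\<close> and \<open>G\<close> agree at \<open>x\<close>, either case settles
  \<open>F\<close>.\<close>

lemma F_sign_of_binomial:
  assumes x: "x < 0" and eq: "poly F x = poly G x"
    and j: "j \<le> m" "c j > 0" and l: "0 < l" "l \<le> Suc m" "c l > 0"
  shows "poly F x * poly (tri_eulerian 0 (Suc m) 0) x > 0"
proof (cases "poly (first_letter_eulerian (Suc m) 0) x = 0")
  case False
  define s where "s = sgn (poly (first_letter_eulerian (Suc m) 0) x)"
  let ?b = "poly (tri_eulerian 0 (Suc m) 0) x"
  have dc: "down_crossing (Suc m) (\<lambda>j. s * poly (first_letter_eulerian (Suc m) j) x)"
    using sign_pattern_first_letter_eulerian[OF x, of "Suc m"] False by (simp add: s_def)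
  have 1: "s * poly G x > 0" if b: "s * ?b \<ge> 0"
    unfolding poly_G
  proof (rule weighted_sum_pos[where j = j])
    fix k assume "k \<le> Suc m"
    thus "s * poly (tri_eulerian 0 k (Suc m - k)) x \<ge> 0"
      using tri_eulerian_first_pos[OF x dc b, of k] b by (cases "k = Suc m") auto
  qed (use j c_nonneg tri_eulerian_first_pos[OF x dc b, of j] in auto)
  have 2: "(- s) * poly F x > 0" if b: "s * ?b \<le> 0"
    unfolding poly_F
  proof (rule weighted_sum_pos[where j = j])
    fix k assume "k \<le> Suc m"
    thus "(- s) * poly (tri_eulerian (Suc m - k) k 0) x \<ge> 0"
      using tri_eulerian_last_neg[OF x dc b, of k] b by (cases "k = Suc m") auto
  qed (use j c_nonneg tri_eulerian_last_neg[OF x dc b, of j] in auto)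
  have same: "v * u > 0" if "t * u > 0" "t * v > 0" for t u v :: real
    using that by (auto simp: zero_less_mult_iff)
  \<comment> \<open>A zero would give the common value of \<open>F\<close> and \<open>G\<close> both
    strict signs.\<close>
  have "s * ?b \<noteq> 0" using 1 2 eq by auto
  hence "s * ?b > 0 \<or> (- s) * ?b > 0" by linarith
  thus ?thesis
  proof
    assume b: "s * ?b > 0"
    show ?thesis by (rule same[OF b]) (use 1 b eq in simp)
  next
    assume b: "(- s) * ?b > 0"
    show ?thesis by (rule same[OF b 2]) (use b in simp)
  qed
next
  case True
  define s where "s = - sgn (poly (first_letter_eulerian m 0) x)"
  note pat = sign_pattern_first_letter_eulerian[OF x, of "Suc m", THEN conjunct2, rule_format, OF True]
  have pos: "\<And>j. 0 < j \<Longrightarrow> j < Suc m \<Longrightarrow> s * poly (first_letter_eulerian (Suc m) j) x > 0"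
    using pat by (simp add: s_def)
  have tri: "s * poly (tri_eulerian a b c) x \<ge> 0 \<and>
    (b = 0 \<and> (a = 0 \<or> c = 0) \<or> s * poly (tri_eulerian a b c) x > 0)" if "a + b + c = Suc m" for a b c
    by (rule tri_eulerian_pos_corner[OF x True pos that]) (use pat in auto)
  have "s * poly (tri_eulerian 0 (Suc m) 0) x > 0" using tri[of 0 "Suc m" 0] by simp
  moreover have "s * poly F x > 0"
    unfolding poly_F
  \<comment> \<open>The term \<open>k = 0\<close> is a vanishing corner entry, so strictness comes
    from a positive index.\<close>
  proof (rule weighted_sum_pos[where j = l])
    show "s * poly (tri_eulerian (Suc m - k) k 0) x \<ge> 0" if "k \<le> Suc m" for k
      using tri[of "Suc m - k" k 0] that by simp
    show "s * poly (tri_eulerian (Suc m - l) l 0) x > 0"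
      using tri[of "Suc m - l" l 0] l by simp
  qed (use l c_nonneg in auto)
  ultimately show ?thesis by (auto simp: zero_less_mult_iff)
qed

text \<open>At the roots of \<open>B\<close> the polynomials \<open>A\<close>, \<open>F\<close> and
  \<open>G\<close> coincide, so \<open>A\<close> has the sign of the transform of
  \<open>(1+x)^(m+1)\<close>, which alternates as these roots separate the
  \<open>T i\<close>.\<close>

lemma B_interlaces_A: "B \<preceq> A"
proof (cases "\<exists>j\<le>m. c j > 0")
  case False
  \<comment> \<open>Only a multiple of \<open>(1+x)^(m+1)\<close> is left, whose transform is
    already symmetric.\<close>
  hence "c j = 0" if "j \<le> m" for j using c_nonneg[of j] that by (metis le_SucI less_eq_real_def)
  hence "B = 0" unfolding B_def by (intro sum.neutral) (auto simp: le_Suc_eq dec_b_0)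
  moreover from this have "A = F" by (simp add: F_eq)
  ultimately show ?thesis using real_rooted_F by (simp add: interlaces_0_left)
next
  case True
  then obtain j where j: "j \<le> m" "c j > 0" by blast
  obtain W where W: "strict_desc_roots B m W" "\<And>i. i < m \<Longrightarrow> T (Suc i) < W i" "\<And>i. i < m \<Longrightarrow> W i < T i"
    using B_roots[OF j] by blast
  have rB: "real_rooted B" by (rule strict_desc_roots_real_rooted[OF W(1)])
  show ?thesis
  proof (cases "A = 0")
    case True
    thus ?thesis using rB by (simp add: interlaces_0_right)
  next
    case False
    \<comment> \<open>Otherwise only the weight of \<open>x^(m+1)\<close> survives, and then
      \<open>A\<close> vanishes.\<close>
    have "\<exists>l. 0 < l \<and> l \<le> Suc m \<and> c l > 0"
    proof (rule ccontr)
      assume no: "\<not> ?thesis"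
      have "c k = 0" if "0 < k" "k \<le> Suc m" for k
        using no c_nonneg[of k] that by (metis less_eq_real_def)
      hence "A = 0" unfolding A_def
        by (intro sum.neutral ballI) (metis atMost_iff dec_a_no_optional diff_zero neq0_conv smult_0_left smult_0_right)
      thus False using \<open>A \<noteq> 0\<close> by simp
    qed
    then obtain l where l: "0 < l" "l \<le> Suc m" "c l > 0" by blast
    have co: "coeff (tri_eulerian 0 (Suc m) 0) (Suc m) = 1"
      using coeff_tri_eulerian_top[of 0 "Suc m"] by simp
    have W_neg: "W i < 0" if "i < m" for i using W(3)[OF that] T_neg[of i] that by simp
    have sgnA: "(-1) ^ Suc i * poly A (W i) > 0" if i: "i < m" for i
    proof -
      have "poly B (W i) = 0" using W(1) i by (simp add: strict_desc_roots_def)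
      hence eq: "poly F (W i) = poly A (W i)" "poly G (W i) = poly A (W i)"
        by (simp_all add: poly_F_eq poly_G_eq)
      have "poly A (W i) * poly (tri_eulerian 0 (Suc m) 0) (W i) > 0"
        using F_sign_of_binomial[OF W_neg[OF i] _ j l] eq by simp
      moreover have "(-1) ^ Suc i * poly (tri_eulerian 0 (Suc m) 0) (W i) > 0"
      proof (rule strict_desc_roots_sign[OF T])
        show "lead_coeff (tri_eulerian 0 (Suc m) 0) > 0" using T co by (simp add: strict_desc_roots_def)
        show "W i < T k" if "k < Suc i" for k
          using T_desc[of k i] W(3)[OF i] i that by (cases "k = i") auto
        show "T k < W i" if "Suc i \<le> k" "k < Suc m" for k
          using T_desc[of "Suc i" k] W(2)[OF i] that by (cases "k = Suc i") auto
      qed (use i in auto)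
      ultimately show ?thesis by (auto simp: zero_less_mult_iff mult_less_0_iff)
    qed
    \<comment> \<open>The point 0, where \<open>A\<close> is nonnegative, is the first of the
      \<open>m + 1\<close> sample points.\<close>
    define Y where "Y = (\<lambda>i. if i = 0 then 0 else W (i - 1))"
    have Y_desc: "Y (Suc i) \<le> Y i" if "i < m" for i
      using W_neg[of 0] W(1) that by (cases i) (auto simp: Y_def strict_desc_roots_def intro: less_imp_le)
    have A0: "poly A 0 \<ge> 0" unfolding poly_0_coeff_0 using gamma_positive_shape[OF gamma_A] by blast
    have Y_sgn: "(-1) ^ i * poly A (Y i) \<ge> 0" if "i \<le> m" for i
      using sgnA[of "i - 1"] A0 that by (cases i) (auto simp: Y_def)
    have W_ne: "poly A (W i) \<noteq> 0" if "i < m" for i using sgnA[OF that] by auto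
    have degA: "degree A \<le> Suc m" using gamma_positive_shape[OF gamma_A] by blast
    \<comment> \<open>If the top coefficient vanishes, the \<open>m\<close> gaps give all roots;
      otherwise one more comes from the unbounded interval on the left. Interlacing permits both
      counts.\<close>
    obtain V d where V: "d = m \<or> d = Suc m" "degree A \<le> d"
      "\<And>i. i < d \<Longrightarrow> V i \<le> Y i \<and> poly A (V i) = 0" "\<And>i. i < m \<Longrightarrow> Y (Suc i) \<le> V i"
    proof (cases "coeff A (Suc m) = 0")
      case True
      hence "degree A \<le> m" using degA \<open>A \<noteq> 0\<close> by (metis le_SucE leading_coeff_0_iff)
      moreover obtain V where "\<And>i. i < m \<Longrightarrow> Y (Suc i) \<le> V i \<and> V i \<le> Y i \<and> poly A (V i) = 0"
        using alternating_roots[of m Y A] Y_desc Y_sgn by blast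
      ultimately show ?thesis using that[of m V] by blast
    next
      case False
      hence deg: "degree A = Suc m" using degA by (metis le_antisym le_degree)
      have "coeff A (Suc m) \<ge> 0" using gamma_positive_shape[OF gamma_A] by blast
      hence lc: "lead_coeff A > 0" using False deg by simp
      have "\<exists>Z. \<forall>i<Suc m. (Suc i < Suc m \<longrightarrow> Y (Suc i) \<le> Z i) \<and> Z i \<le> Y i \<and> poly A (Z i) = 0"
        by (rule alternating_roots_unbounded[OF lc deg]) (use Y_desc Y_sgn in auto)
      then obtain V where "\<forall>i<Suc m. (Suc i < Suc m \<longrightarrow> Y (Suc i) \<le> V i) \<and> V i \<le> Y i \<and> poly A (V i) = 0"
        by blast
      thus ?thesis using that[of "Suc m" V] deg by simp
    qed
    have V1: "W i \<le> V i" if "i < m" for i using V(4)[OF that] by (simp add: Y_def)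
    have V2: "V (Suc i) \<le> W i" if "Suc i < d" for i using V(3)[OF that] by (simp add: Y_def)
    have "strict_desc_roots A d V"
    proof (rule strict_desc_rootsI)
      fix i assume i: "Suc i < d"
      hence "i < m" using V(1) by auto
      \<comment> \<open>Consecutive intervals meet only in \<open>W i\<close>, which is no root of
        \<open>A\<close>.\<close>
      have "V i \<noteq> W i" using W_ne[OF \<open>i < m\<close>] V(3)[of i] i by auto
      thus "V (Suc i) < V i" using V1[OF \<open>i < m\<close>] V2[OF i] by simp
    qed (use V \<open>A \<noteq> 0\<close> in auto)
    thus ?thesis
      by (rule strict_desc_roots_interlaces[OF W(1)]) (use V V1 V2 in auto)
  qed
qed

end

lemma strict_desc_roots_const:
  assumes "c \<noteq> 0"
  shows "strict_desc_roots [:c:] 0 z"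
  using assms by (simp add: strict_desc_roots_def)

theorem theorem1p1:
  fixes n :: nat and p :: "real poly"
  assumes "p \<in> P_class n"
  shows "(real_rooted (eulerian_transform p) \<and>
          eulerian_transform p \<preceq> [:0, 1:] * eulerian_poly n \<and>
          eulerian_transform ([:1, 1:] ^ n) \<preceq> eulerian_transform p) \<and>
         (\<exists>a b. symmetric_decomposition n (eulerian_transform p) a b \<and>
            nonneg_coeffs a \<and> nonneg_coeffs b \<and>
            real_rooted a \<and> real_rooted b \<and> b \<preceq> a \<and>
            unimodal n a \<and> unimodal (n - 1) b \<and>
            gamma_positive n a \<and> gamma_positive (n - 1) b)"
proof -
  obtain c where c: "\<And>k. k \<le> n \<Longrightarrow> c k \<ge> 0"
    and p: "p = (\<Sum>k\<le>n. smult (c k) ([:0, 1:] ^ (n - k) * [:1, 1:] ^ k))"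
    using assms unfolding P_class_def by blast
  have E: "eulerian_transform p = (\<Sum>k\<le>n. smult (c k) (tri_eulerian (n - k) k 0))"
    unfolding p by (simp only: eulerian_transform_sum eulerian_transform_smult eulerian_transform_tri_eulerian)
  have E1: "eulerian_transform ([:1, 1:] ^ n) = tri_eulerian 0 n 0"
    using eulerian_transform_tri_eulerian[of 0 n] by simp
  show ?thesis
  proof (cases n)
    \<comment> \<open>The transform is the constant \<open>c 0\<close>, so the decomposition has
      second component 0.\<close>
    case 0
    have E0: "eulerian_transform p = [:c 0:]" and one: "eulerian_transform ([:1, 1:] ^ n) = [:1:]"
      using E E1 0 by (simp_all add: one_pCons)
    have x: "strict_desc_roots [:0, 1:] 1 (\<lambda>_. 0)" by (simp add: strict_desc_roots_def)
    have 1: "[:c 0:] \<preceq> [:0, 1:]" "[:1:] \<preceq> [:c 0:]"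
    proof -
      have r: "real_rooted [:0, 1:]" "real_rooted [:1:]"
        using strict_desc_roots_real_rooted[OF x] strict_desc_roots_real_rooted[OF strict_desc_roots_const[of 1]]
        by auto
      show "[:c 0:] \<preceq> [:0, 1:]"
        using interlaces_0_left[OF r(1)] strict_desc_roots_interlaces[OF strict_desc_roots_const x]
        by (cases "c 0 = 0") auto
      show "[:1:] \<preceq> [:c 0:]"
        using interlaces_0_right[OF r(2)]
          strict_desc_roots_interlaces[OF strict_desc_roots_const[of 1] strict_desc_roots_const[of "c 0"]]
        by (cases "c 0 = 0") auto
    qed
    have rr: "real_rooted [:c 0:]" using 1 interlaces_imp_real_rooted by blast
    have "gamma_positive 0 (smult (c 0) 1)"
      using gamma_positive_basis[of 0 0] c[of 0] by (intro gamma_positive_smult) simp_all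
    hence g: "gamma_positive n [:c 0:]" using 0 by simp
    have "symmetric_decomposition n (eulerian_transform p) [:c 0:] 0"
      using gamma_positive_imp_symmetric[OF g] E0 0 by (simp add: symmetric_decomposition_def)
    moreover have "real_rooted 0" by (simp add: real_rooted_def)
    moreover have "[:c 0:] \<preceq> [:0, 1:] * eulerian_poly n" using 1(1) 0 by (simp add: eulerian_poly_0)
    ultimately show ?thesis
      unfolding one E0
      by (intro conjI exI[of _ "[:c 0:]"] exI[of _ 0] 1(2) rr g gamma_positive_0 interlaces_0_left
          gamma_positive_imp_nonneg[OF g] gamma_positive_imp_nonneg[OF gamma_positive_0]
          gamma_positive_imp_unimodal)
  next
    case (Suc m)
    obtain R where R: "eulerian_root_seq (Suc m) R" using eulerian_root_seq_exists by blast
    obtain T where T: "strict_desc_roots (tri_eulerian 0 (Suc m) 0) (Suc m) T"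
      "\<forall>i\<le>m. T i < R i" "\<forall>i<m. R (Suc i) < T i"
      using binomial_eulerian_roots[OF R] by blast
    interpret eulerian_combination m c R T
      using c R T Suc by unfold_locales auto
    have EF: "eulerian_transform p = F" using E Suc by (simp add: F_def)
    have "symmetric_decomposition n (eulerian_transform p) A B"
      using gamma_positive_imp_symmetric[OF gamma_A] gamma_positive_imp_symmetric[OF gamma_B] Suc
      unfolding symmetric_decomposition_def EF by (simp add: F_eq)
    moreover have "gamma_positive n A" "gamma_positive (n - 1) B" using gamma_A gamma_B Suc by simp_all
    moreover have "F \<preceq> [:0, 1:] * eulerian_poly n" "tri_eulerian 0 n 0 \<preceq> F"
      unfolding Suc by (rule F_interlaces)+
    moreover have "real_rooted A" "real_rooted B"
      using interlaces_imp_real_rooted[OF B_interlaces_A] by auto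
    ultimately show ?thesis
      unfolding E1 EF
      by (intro conjI exI[of _ A] exI[of _ B] real_rooted_F B_interlaces_A
          gamma_positive_imp_nonneg[OF gamma_A] gamma_positive_imp_nonneg[OF gamma_B]
          gamma_positive_imp_unimodal)
  qed
qed

end
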